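(* Let $X\subset\mathbb{R}^n$ be unimodular, and let $\mathcal{Z}_+(X)=Z(X)\cap\mathbb{Z}^n$ be the set of integer points in the closed zonotope $Z(X)=\{\sum_{x\in X}t_xx:t\in[0,1]^X\}$. Then $$\Pi(\mathcal{Z}_+(X))=\mathcal{P}_+(X)=\ker\mathcal{I}_+(X).$$
   Context: $X$ is a finite multiset of nonzero vectors in $\mathbb{R}^n$ spanning $\mathbb{R}^n$ (repeated vectors are treated as distinct elements; subsets, set differences and cardinalities are taken with multiplicity). $X$ is unimodular if $X\subset\mathbb{Z}^n$ and every $B\subset X$ that is a basis of $\mathbb{R}^n$ satisfies $\det B=\pm1$. $\Pi=\mathbb{C}[t_1,\dots,t_n]$. For a nonzero power series $f=f_0+f_1+\cdots$ with $f_j$ homogeneous of degree $j$, $f_\downarrow$ is the nonzero $f_j$ of smallest $j$; $0_\downarrow=0$. For finite $\sigma\subset\mathbb{R}^n$, $\mathrm{Exp}(\sigma)=\mathrm{span}_{\mathbb{C}}\{t\mapsto e^{\alpha\cdot t}:\alpha\in\sigma\}$ and $\Pi(\sigma)=\mathrm{span}\{f_\downarrow:f\in\mathrm{Exp}(\sigma)\}$. For $y\in\mathbb{R}^n$, $p_y(t)=y\cdot t$; $p_Y=\prod_{y\in Y}p_y$ (with $p_\emptyset=1$); $\mathcal{P}_+(X)=\mathrm{span}_{\mathbb{C}}\{p_Y:Y\subset X\}$. $\mathcal{F}(X)$ is the set of linear subspaces $H\subset\mathbb{R}^n$ with $\dim H=n-1$ and $\mathrm{span}(X\cap H)=H$;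 $\eta_H$ is a nonzero normal to $H$, $m(H)=\#(X\setminus H)$, and $\mathcal{I}_+(X)$ is the ideal generated by $p_{\eta_H}^{m(H)+1}$, $H\in\mathcal{F}(X)$. For a homogeneous ideal $I$, $\ker I=\{p\in\Pi:q(D)p=0\ \forall q\in I\}$ with $q(D)=q(\partial/\partial t_1,\dots,\partial/\partial t_n)$. *)

theory Defs
  imports "HOL-Analysis.Analysis" "HOL-Library.Poly_Mapping"
begin

subsection \<open>The polynomial ring\<close>

text \<open>
  The coordinates of the ambient space are indexed by the finite type \<open>'n\<close>. A polynomial is
  the finitely supported map from exponent vectors to coefficients; the ring structure is that of
  \<^theory>\<open>HOL-Library.Poly_Mapping\<close>.
\<close>

type_synonym 'n cpoly = "('n \<Rightarrow>\<^sub>0 nat) \<Rightarrow>\<^sub>0 complex"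

definition cpoly_scale :: "complex \<Rightarrow> 'n cpoly \<Rightarrow> 'n cpoly" where
  "cpoly_scale c p = Poly_Mapping.single 0 c * p"

global_interpretation cpoly: vector_space cpoly_scale
  by unfold_locales
    (simp_all add: cpoly_scale_def distrib_left distrib_right single_add mult_single
      mult.assoc [symmetric])

text \<open>The span of a set in a commutative ring acting on itself is the ideal it generates.\<close>

global_interpretation ring_ideal: module "(*) :: 'a::comm_ring_1 \<Rightarrow> 'a \<Rightarrow> 'a"
  by unfold_locales (simp_all add: algebra_simps)

definition cpoly_eval :: "('n::finite) cpoly \<Rightarrow> real ^ 'n \<Rightarrow> complex" where
  "cpoly_eval p t =
     (\<Sum>m\<in>Poly_Mapping.keys p.
        Poly_Mapping.lookup p m * (\<Prod>k\<in>UNIV. complex_of_real (t $ k) ^ Poly_Mapping.lookup m k))"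

definition homogeneous :: "nat \<Rightarrow> ('n::finite) cpoly \<Rightarrow> bool" where
  "homogeneous d p \<longleftrightarrow>
     (\<forall>m\<in>Poly_Mapping.keys p. (\<Sum>k\<in>UNIV. Poly_Mapping.lookup m k) = d)"

subsection \<open>Constant coefficient differential operators\<close>

definition partial :: "'n \<Rightarrow> 'n cpoly \<Rightarrow> 'n cpoly" where
  "partial k p =
     (\<Sum>m\<in>Poly_Mapping.keys p.
        Poly_Mapping.single (m - Poly_Mapping.single k 1)
          (of_nat (Poly_Mapping.lookup m k) * Poly_Mapping.lookup p m))"

lemma lookup_partial:
  "Poly_Mapping.lookup (partial k p) m =
     of_nat (Poly_Mapping.lookup m k + 1) * Poly_Mapping.lookup p (m + Poly_Mapping.single k 1)"
proof -
  let ?e = "Poly_Mapping.single k (1::nat)"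
  have *: "n = m + ?e" if "n - ?e = m" "Poly_Mapping.lookup n k \<noteq> 0" for n
  proof (rule poly_mapping_eqI)
    fix j
    show "Poly_Mapping.lookup n j = Poly_Mapping.lookup (m + ?e) j"
      using that by (auto simp: lookup_add lookup_minus lookup_single when_def)
  qed
  have "Poly_Mapping.lookup (partial k p) m =
      (\<Sum>n\<in>Poly_Mapping.keys p.
        of_nat (Poly_Mapping.lookup n k) * Poly_Mapping.lookup p n when n - ?e = m)"
    by (simp add: partial_def lookup_sum lookup_single)
  also have "\<dots> = (\<Sum>n\<in>Poly_Mapping.keys p.
      if n = m + ?e then of_nat (Poly_Mapping.lookup n k) * Poly_Mapping.lookup p n else 0)"
    using * by (intro sum.cong refl) (auto simp: when_def)
  also have "\<dots> = of_nat (Poly_Mapping.lookup m k + 1) * Poly_Mapping.lookup p (m + ?e)"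
    by (auto simp: lookup_add in_keys_iff)
  finally show ?thesis .
qed

lemma partial_commute: "partial j (partial k p) = partial k (partial j p)"
  by (rule poly_mapping_eqI)
    (cases "j = k", auto simp: lookup_partial lookup_add lookup_single when_def add_ac)

text \<open>
  The order in which the coordinates are processed by the fold is irrelevant, as partial
  derivatives commute.
\<close>

definition mixed_partial :: "('n::finite \<Rightarrow>\<^sub>0 nat) \<Rightarrow> 'n cpoly \<Rightarrow> 'n cpoly" where
  "mixed_partial m p = Finite_Set.fold (\<lambda>k. partial k ^^ Poly_Mapping.lookup m k) p UNIV"

lemma comp_fun_commute_partial: "comp_fun_commute (\<lambda>k. partial k ^^ e k)"
proof -
  have 1: "partial j \<circ> (partial k ^^ b) = (partial k ^^ b) \<circ> partial j" for j k :: 'a and b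
    by (induction b) (auto simp: fun_eq_iff partial_commute [of j k])
  have "(partial j ^^ a) \<circ> (partial k ^^ b) = (partial k ^^ b) \<circ> (partial j ^^ a)"
    for j k :: 'a and a b
    using 1 by (induction a) (auto simp: fun_eq_iff)
  then show ?thesis
    by unfold_locales
qed

definition diff_op :: "('n::finite) cpoly \<Rightarrow> 'n cpoly \<Rightarrow> 'n cpoly" where
  "diff_op q p =
     (\<Sum>m\<in>Poly_Mapping.keys q. cpoly_scale (Poly_Mapping.lookup q m) (mixed_partial m p))"

definition ideal_kernel :: "('n::finite) cpoly set \<Rightarrow> 'n cpoly set" where
  "ideal_kernel J = {p. \<forall>q\<in>J. diff_op q p = 0}"

subsection \<open>Least parts of exponential sums\<close>

text \<open>The span of the exponentials is only meaningful here for finite \<open>\<sigma>\<close>.\<close>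

definition Exp_space :: "(real ^ 'n::finite) set \<Rightarrow> (real ^ 'n \<Rightarrow> complex) set" where
  "Exp_space \<sigma> =
     {(\<lambda>t. \<Sum>\<alpha>\<in>\<sigma>. c \<alpha> * complex_of_real (exp (\<alpha> \<bullet> t))) | c. True}"

text \<open>\<open>F j\<close> is the homogeneous component of degree \<open>j\<close> of the power series of \<open>f\<close>.\<close>

definition homogeneous_expansion ::
  "(real ^ 'n::finite \<Rightarrow> complex) \<Rightarrow> (nat \<Rightarrow> 'n cpoly) \<Rightarrow> bool" where
  "homogeneous_expansion f F \<longleftrightarrow>
     (\<forall>j. homogeneous j (F j)) \<and> (\<forall>t. (\<lambda>j. cpoly_eval (F j) t) sums f t)"

definition least_part :: "(nat \<Rightarrow> 'n cpoly) \<Rightarrow> 'n cpoly" where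
  "least_part F = (if \<forall>j. F j = 0 then 0 else F (LEAST j. F j \<noteq> 0))"

definition least_space :: "(real ^ 'n::finite) set \<Rightarrow> 'n cpoly set" where
  "least_space \<sigma> =
     cpoly.span {least_part F | f F. f \<in> Exp_space \<sigma> \<and> homogeneous_expansion f F}"

subsection \<open>Zonotopal spaces\<close>

text \<open>
  The multiset \<open>X\<close> is the family of the vectors \<open>x i\<close>, \<open>i \<in> I\<close>; sub-multisets
  correspond to subsets of the index set \<open>I\<close>.
\<close>

definition integer_points :: "(real ^ 'n) set" where
  "integer_points = {z. \<forall>k. z $ k \<in> \<int>}"

definition is_basis_family :: "'i set \<Rightarrow> ('i \<Rightarrow> real ^ 'n::finite) \<Rightarrow> bool" where
  "is_basis_family B x \<longleftrightarrow> inj_on x B \<and> independent (x ` B) \<and> span (x ` B) = UNIV"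

text \<open>
  The determinant of a basis is that of the matrix with the basis vectors as columns, for every
  enumeration of the basis by \<open>'n\<close>; a different enumeration only affects the sign.
\<close>

definition unimodular :: "'i set \<Rightarrow> ('i \<Rightarrow> real ^ 'n::finite) \<Rightarrow> bool" where
  "unimodular I x \<longleftrightarrow>
     x ` I \<subseteq> integer_points \<and>
     (\<forall>B\<subseteq>I. is_basis_family B x \<longrightarrow>
        (\<forall>b. bij_betw b (UNIV :: 'n set) B \<longrightarrow> det (\<chi> r c. x (b c) $ r) \<in> {1, -1}))"

definition zonotope :: "'i set \<Rightarrow> ('i \<Rightarrow> real ^ 'n::finite) \<Rightarrow> (real ^ 'n) set" where
  "zonotope I x = {\<Sum>i\<in>I. s i *\<^sub>R x i | s. \<forall>i\<in>I. s i \<in> {0..1}}"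

definition linear_form :: "real ^ 'n::finite \<Rightarrow> 'n cpoly" where
  "linear_form y =
     (\<Sum>k\<in>UNIV. Poly_Mapping.single (Poly_Mapping.single k 1) (complex_of_real (y $ k)))"

definition P_plus :: "'i set \<Rightarrow> ('i \<Rightarrow> real ^ 'n::finite) \<Rightarrow> 'n cpoly set" where
  "P_plus I x = cpoly.span {\<Prod>i\<in>Y. linear_form (x i) | Y. Y \<subseteq> I}"

definition facet_hyperplanes :: "'i set \<Rightarrow> ('i \<Rightarrow> real ^ 'n::finite) \<Rightarrow> (real ^ 'n) set set" where
  "facet_hyperplanes I x =
     {H. subspace H \<and> dim H = CARD('n) - 1 \<and> span (x ` {i\<in>I. x i \<in> H}) = H}"

definition is_normal :: "(real ^ 'n::finite) set \<Rightarrow> real ^ 'n \<Rightarrow> bool" where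
  "is_normal H y \<longleftrightarrow> y \<noteq> 0 \<and> (\<forall>h\<in>H. y \<bullet> h = 0)"

definition I_plus ::
  "'i set \<Rightarrow> ('i \<Rightarrow> real ^ 'n::finite) \<Rightarrow> ((real ^ 'n) set \<Rightarrow> real ^ 'n) \<Rightarrow> 'n cpoly set" where
  "I_plus I x \<eta> =
     ring_ideal.span
       {linear_form (\<eta> H) ^ (card {i\<in>I. x i \<notin> H} + 1) | H. H \<in> facet_hyperplanes I x}"

end

theory Submission
  imports Defs
begin

text \<open>
  No dimension count is needed: the spaces are compared by a cycle of three inclusions.

  The product \<open>p\<^sub>Y\<close> is the least part of \<open>\<Prod>y\<in>Y. (exp (y \<bullet> t) - 1)\<close>, whose frequencies are
  the subset sums of \<open>Y\<close>; hence \<open>P\<^sub>+(X)\<close> lies in the least space of the integer points of the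
  zonotope.

  For a facet hyperplane \<open>H\<close> with normal \<open>\<eta>\<close>, unimodularity makes \<open>\<eta>\<close>, suitably rescaled,
  integral on integer points with values \<open>0, \<plusminus>1\<close> on \<open>X\<close>. It therefore takes at most
  \<open>m(H) + 1\<close> values \<open>v\<close> on these points of the zonotope. The product of the operators
  \<open>D\<^sub>\<eta> - v\<close> annihilates the exponential space, so its leading term, a power of \<open>D\<^sub>\<eta>\<close>,
  annihilates the least parts.

  Finally, \<open>ker I\<^sub>+(X) \<subseteq> P\<^sub>+(X)\<close> by induction on \<open>X\<close>. Restricting \<open>p\<close> in the kernel to the
  orthogonal complement of some \<open>x \<in> X\<close> gives an element of the kernel for the contraction
  \<open>X / x\<close>. Subtracting a suitable combination of products thus leaves a multiple \<open>p\<^sub>x q\<close> in the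
  kernel, and then \<open>q\<close> is in the kernel for the deletion \<open>X - x\<close>.
\<close>

text \<open>This rule rewrites against \<open>mult.assoc\<close>.\<close>

declare ring_ideal.scale_scale [simp del]

subsection \<open>Induction principles\<close>

lemma poly_mapping_add_single_induct [case_names single add]:
  fixes p :: "'a \<Rightarrow>\<^sub>0 'b::comm_monoid_add"
  assumes single: "\<And>m c. P (Poly_Mapping.single m c)"
    and add: "\<And>p q. P p \<Longrightarrow> P q \<Longrightarrow> P (p + q)"
  shows "P p"
proof -
  have "P (\<Sum>m\<in>S. Poly_Mapping.single m (Poly_Mapping.lookup p m))" if "finite S" for S
    using that
  proof (induction S rule: finite_induct)
    case empty
    \<comment> \<open>Zero is itself a monomial with coefficient 0, so the induction has no separate
      base case.\<close>
    show ?case using single [of undefined 0] by simp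
  qed (simp add: add single)
  moreover have "p = (\<Sum>m\<in>Poly_Mapping.keys p. Poly_Mapping.single m (Poly_Mapping.lookup p m))"
    by (rule poly_mapping_eqI) (auto simp: lookup_sum lookup_single when_def in_keys_iff)
  ultimately show ?thesis
    by (metis finite_keys)
qed

lemma exponent_induct [case_names zero Suc]:
  fixes m :: "'a \<Rightarrow>\<^sub>0 nat"
  assumes "P 0" and "\<And>m k. P m \<Longrightarrow> P (m + Poly_Mapping.single k 1)"
  shows "P m"
proof -
  \<comment> \<open>Generalizing over the starting exponent makes the sum case a composition of two
    walks.\<close>
  have "\<forall>n. P n \<longrightarrow> P (n + m)"
  proof (induction m rule: poly_mapping_add_single_induct)
    case (single k N)
    show ?case
    proof (induction N)
      case (Suc N)
      have "Poly_Mapping.single k (Suc N) = Poly_Mapping.single k N + Poly_Mapping.single k 1"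
        by (simp flip: single_add)
      with Suc assms(2) show ?case
        by (metis add.assoc)
    qed simp
  next
    case (add p q)
    then show ?case by (metis add.assoc)
  qed
  from this [rule_format, OF assms(1)] show ?thesis by simp
qed

abbreviation cpoly_var :: "'n \<Rightarrow> 'n cpoly" where
  "cpoly_var k \<equiv> Poly_Mapping.single (Poly_Mapping.single k 1) 1"

text \<open>Identities for derivations and ring homomorphisms then need checking only on constants
  and variables.\<close>

lemma cpoly_induct [case_names const add var]:
  fixes p :: "'n cpoly"
  assumes const: "\<And>c. P (Poly_Mapping.single 0 c)"
    and add: "\<And>p q. P p \<Longrightarrow> P q \<Longrightarrow> P (p + q)"
    and var: "\<And>p k. P p \<Longrightarrow> P (p * cpoly_var k)"
  shows "P p"
proof (induction p rule: poly_mapping_add_single_induct)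
  case (single m c)
  show ?case
  proof (induction m rule: exponent_induct)
    case (Suc m k)
    from var [OF this, of k] show ?case by (simp add: mult_single)
  qed (rule const)
qed (rule add)

subsection \<open>Differential operators\<close>

lemma lookup_cpoly_scale [simp]:
  "Poly_Mapping.lookup (cpoly_scale c p) m = c * Poly_Mapping.lookup p m"
proof (induction p rule: poly_mapping_add_single_induct)
  case (add p q)
  then show ?case by (simp add: cpoly.scale_right_distrib lookup_add distrib_left)
qed (auto simp: cpoly_scale_def mult_single lookup_single when_def)

lemma partial_add: "partial k (p + q) = partial k p + partial k q"
  by (rule poly_mapping_eqI) (simp add: lookup_partial lookup_add algebra_simps)

lemma partial_scale: "partial k (cpoly_scale c p) = cpoly_scale c (partial k p)"
  by (rule poly_mapping_eqI) (simp add: lookup_partial)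

lemma partial_single:
  "partial k (Poly_Mapping.single m c) =
     Poly_Mapping.single (m - Poly_Mapping.single k 1) (of_nat (Poly_Mapping.lookup m k) * c)"
  by (cases "c = 0") (simp_all add: partial_def)

lemma partial_mult: "partial k (p * q) = partial k p * q + p * partial k q"
proof (induction p rule: poly_mapping_add_single_induct)
  case (add p p')
  then show ?case by (simp add: partial_add algebra_simps)
next
  case (single m c)
  show ?case
  proof (induction q rule: poly_mapping_add_single_induct)
    case (add q q')
    then show ?case by (simp add: partial_add algebra_simps)
  next
    case (single n d)
    let ?e = "Poly_Mapping.single k (1::nat)"
    \<comment> \<open>Subtraction of exponents truncates at 0, so regrouping needs a positive
      exponent of \<open>k\<close>; otherwise the coefficient is 0 and the two monomials still
      agree.\<close>
    have *: "m + n - ?e = (m - ?e) + n" if "Poly_Mapping.lookup m k \<noteq> 0" for m n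
      using that by (intro poly_mapping_eqI) (auto simp: lookup_add lookup_minus lookup_single when_def)
    have 1: "Poly_Mapping.single (m + n - ?e) (of_nat (Poly_Mapping.lookup m k) * c * d) =
        Poly_Mapping.single (m - ?e + n) (of_nat (Poly_Mapping.lookup m k) * c * d)"
      using * [of m n] by (cases "Poly_Mapping.lookup m k = 0") auto
    have 2: "Poly_Mapping.single (m + n - ?e) (of_nat (Poly_Mapping.lookup n k) * c * d) =
        Poly_Mapping.single (m + (n - ?e)) (of_nat (Poly_Mapping.lookup n k) * c * d)"
      using * [of n m] by (cases "Poly_Mapping.lookup n k = 0") (auto simp: add.commute)
    have "partial k (Poly_Mapping.single m c * Poly_Mapping.single n d) =
        Poly_Mapping.single (m + n - ?e) (of_nat (Poly_Mapping.lookup m k) * c * d) +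
        Poly_Mapping.single (m + n - ?e) (of_nat (Poly_Mapping.lookup n k) * c * d)"
      by (simp only: mult_single partial_single lookup_add of_nat_add distrib_right mult.assoc single_add)
    then show ?case
      unfolding 1 2 by (simp only: mult_single partial_single mult_ac add_ac)
  qed
qed

lemma comp_fun_commute_on_partial: "comp_fun_commute_on UNIV (\<lambda>k. partial k ^^ e k)"
  using comp_fun_commute_partial by (simp add: comp_fun_commute_def')

lemma mixed_partial_0 [simp]: "mixed_partial 0 p = p"
proof -
  have "Finite_Set.fold (\<lambda>k. partial k ^^ Poly_Mapping.lookup (0 :: 'a \<Rightarrow>\<^sub>0 nat) k) p S = p" for S
  proof (cases "finite S")
    case True
    then show ?thesis
    proof (induction S rule: finite_induct)
      case (insert k S)
      then show ?case
        by (subst comp_fun_commute_on.fold_insert [OF comp_fun_commute_on_partial]) (simp_all add: id_def)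
    qed simp
  qed simp
  then show ?thesis by (simp add: mixed_partial_def)
qed

text \<open>Commuting derivatives allow coordinate \<open>k\<close> to be processed last, and the
  fold over the other coordinates does not see the extra unit.\<close>

lemma mixed_partial_add_single:
  "mixed_partial (m + Poly_Mapping.single k 1) p = partial k (mixed_partial m p)"
proof -
  let ?f = "\<lambda>m k. partial k ^^ Poly_Mapping.lookup m k"
  have rec: "mixed_partial m p = ?f m k (Finite_Set.fold (?f m) p (UNIV - {k}))" for m
    unfolding mixed_partial_def
    by (rule comp_fun_commute_on.fold_rec [OF comp_fun_commute_on_partial]) auto
  have "Finite_Set.fold (?f (m + Poly_Mapping.single k 1)) p (UNIV - {k}) =
      Finite_Set.fold (?f m) p (UNIV - {k})"
    by (rule Finite_Set.fold_cong [OF comp_fun_commute_on_partial comp_fun_commute_on_partial])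
      (auto simp: lookup_add lookup_single when_def)
  then show ?thesis
    unfolding rec by (simp add: lookup_add)
qed

lemma mixed_partial_add:
  "mixed_partial (m + n) p = mixed_partial m (mixed_partial n p)"
proof (induction m rule: exponent_induct)
  case (Suc m k)
  have "m + Poly_Mapping.single k 1 + n = m + n + Poly_Mapping.single k 1"
    by (simp add: add_ac)
  then show ?case
    by (simp only: mixed_partial_add_single Suc)
qed simp

lemma mixed_partial_add_right:
  "mixed_partial m (p + q) = mixed_partial m p + mixed_partial m q"
proof (induction m rule: exponent_induct)
  case (Suc m k)
  then show ?case by (simp only: mixed_partial_add_single partial_add)
qed simp

lemma mixed_partial_scale:
  "mixed_partial m (cpoly_scale c p) = cpoly_scale c (mixed_partial m p)"
proof (induction m rule: exponent_induct)
  case (Suc m k)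
  then show ?case by (simp only: mixed_partial_add_single partial_scale)
qed simp

lemma diff_op_superset:
  assumes "finite S" "Poly_Mapping.keys q \<subseteq> S"
  shows "diff_op q p = (\<Sum>m\<in>S. cpoly_scale (Poly_Mapping.lookup q m) (mixed_partial m p))"
  unfolding diff_op_def by (rule sum.mono_neutral_left) (use assms in \<open>auto simp: in_keys_iff\<close>)

lemma diff_op_single: "diff_op (Poly_Mapping.single m c) p = cpoly_scale c (mixed_partial m p)"
  by (subst diff_op_superset [of "{m}"]) auto

lemma diff_op_add_left: "diff_op (q + r) p = diff_op q p + diff_op r p"
proof -
  let ?S = "Poly_Mapping.keys q \<union> Poly_Mapping.keys r"
  have "finite ?S" "Poly_Mapping.keys (q + r) \<subseteq> ?S"
    using keys_add [of q r] by auto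
  then show ?thesis
    by (simp add: diff_op_superset [of ?S] lookup_add cpoly.scale_left_distrib sum.distrib)
qed

lemma diff_op_add_right: "diff_op q (p + r) = diff_op q p + diff_op q r"
  by (simp add: diff_op_def mixed_partial_add_right cpoly.scale_right_distrib sum.distrib)

lemma diff_op_scale_right: "diff_op q (cpoly_scale c p) = cpoly_scale c (diff_op q p)"
  by (simp add: diff_op_def mixed_partial_scale cpoly.scale_sum_right mult.commute)

lemma diff_op_mult: "diff_op (q * r) p = diff_op q (diff_op r p)"
proof (induction q rule: poly_mapping_add_single_induct)
  case (add q q')
  then show ?case by (simp add: diff_op_add_left algebra_simps)
next
  case (single m c)
  show ?case
  proof (induction r rule: poly_mapping_add_single_induct)
    case (add r r')
    then show ?case by (simp add: diff_op_add_left diff_op_add_right algebra_simps)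
  next
    case (single n d)
    then show ?case
      by (simp add: mult_single diff_op_single mixed_partial_add mixed_partial_scale)
  qed
qed

lemma diff_op_0_right [simp]: "diff_op q 0 = 0"
  using diff_op_scale_right [of q 0 0] by simp

lemma diff_op_sum_right: "diff_op q (\<Sum>a\<in>A. f a) = (\<Sum>a\<in>A. diff_op q (f a))"
  by (induction A rule: infinite_finite_induct) (simp_all add: diff_op_add_right)

text \<open>By \<open>diff_op_mult\<close>, the operators annihilating a fixed polynomial form an
  ideal, so generators suffice.\<close>

lemma ideal_kernel_span:
  "ideal_kernel (ring_ideal.span G) = {p. \<forall>q\<in>G. diff_op q p = 0}"
proof -
  have "diff_op q p = 0" if "\<forall>q\<in>G. diff_op q p = 0" "q \<in> ring_ideal.span G" for p q
    using that(2)
  proof (induction rule: ring_ideal.span_induct_alt)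
    case base
    show ?case by (simp add: diff_op_def)
  next
    case (step c x y)
    then show ?case using that(1) by (simp add: diff_op_add_left diff_op_mult)
  qed
  then show ?thesis
    unfolding ideal_kernel_def by (auto intro: ring_ideal.span_base)
qed

subsection \<open>Directional derivatives\<close>

abbreviation dderiv :: "real ^ 'n::finite \<Rightarrow> 'n cpoly \<Rightarrow> 'n cpoly" where
  "dderiv \<eta> \<equiv> diff_op (linear_form \<eta>)"

lemma diff_op_linear_form_power: "diff_op (linear_form \<eta> ^ N) p = (dderiv \<eta> ^^ N) p"
proof (induction N)
  case 0
  have "(1 :: 'a cpoly) = Poly_Mapping.single 0 1" by simp
  then show ?case using diff_op_single [of 0 1 p] by simp
qed (simp add: diff_op_mult)

lemma dderiv_eq: "dderiv \<eta> p = (\<Sum>k\<in>UNIV. cpoly_scale (complex_of_real (\<eta> $ k)) (partial k p))"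
proof -
  have *: "diff_op (\<Sum>a\<in>A. f a) p = (\<Sum>a\<in>A. diff_op (f a) p)" for f and A :: "'a set"
    by (induction A rule: infinite_finite_induct) (simp_all add: diff_op_add_left diff_op_def [of 0])
  have "mixed_partial (Poly_Mapping.single k 1) p = partial k p" for k
    using mixed_partial_add_single [of 0 k p] by simp
  then show ?thesis
    unfolding linear_form_def * by (simp add: diff_op_single)
qed

lemma cpoly_scale_mult_left: "cpoly_scale c p * q = cpoly_scale c (p * q)"
  by (simp add: cpoly_scale_def mult.assoc)

lemma cpoly_scale_mult_right: "p * cpoly_scale c q = cpoly_scale c (p * q)"
  by (simp add: cpoly_scale_def mult_ac)

lemma dderiv_mult: "dderiv \<eta> (p * q) = dderiv \<eta> p * q + p * dderiv \<eta> q"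
  by (simp add: dderiv_eq partial_mult cpoly.scale_right_distrib sum.distrib sum_distrib_left
      sum_distrib_right cpoly_scale_mult_left cpoly_scale_mult_right)

lemma dderiv_const [simp]: "dderiv \<eta> (Poly_Mapping.single 0 c) = 0"
  by (simp add: dderiv_eq partial_single)

lemma dderiv_one [simp]: "dderiv \<eta> 1 = 0"
  using dderiv_const [of \<eta> 1] by simp

lemma dderiv_var: "dderiv \<eta> (cpoly_var k) = Poly_Mapping.single 0 (complex_of_real (\<eta> $ k))"
proof -
  have "partial j (cpoly_var k) = Poly_Mapping.single 0 (of_bool (j = k))" for j
    by (auto simp: partial_single lookup_single when_def)
  then have "dderiv \<eta> (cpoly_var k) =
      (\<Sum>j\<in>UNIV. if j = k then Poly_Mapping.single 0 (complex_of_real (\<eta> $ k)) else 0)"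
    unfolding dderiv_eq by (intro sum.cong) (auto simp: cpoly_scale_def mult_single)
  then show ?thesis by simp
qed

lemma linear_form_eq: "linear_form y = (\<Sum>k\<in>UNIV. cpoly_scale (complex_of_real (y $ k)) (cpoly_var k))"
  by (simp add: linear_form_def cpoly_scale_def mult_single)

lemma linear_form_add: "linear_form (a + b) = linear_form a + linear_form b"
  by (simp add: linear_form_eq cpoly.scale_left_distrib sum.distrib)

lemma linear_form_scaleR: "linear_form (c *\<^sub>R a) = cpoly_scale (complex_of_real c) (linear_form a)"
  by (simp add: linear_form_eq cpoly.scale_sum_right)

lemma linear_form_0 [simp]: "linear_form 0 = 0"
  by (simp add: linear_form_eq)

lemma cpoly_var_eq_linear_form: "cpoly_var k = linear_form (axis k 1)"
proof -
  have "linear_form (axis k 1) = (\<Sum>j\<in>UNIV. if j = k then cpoly_var k else 0)"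
    unfolding linear_form_def by (rule sum.cong) (auto simp: axis_def)
  then show ?thesis by simp
qed

lemma dderiv_linear_form:
  "dderiv \<eta> (linear_form y) = Poly_Mapping.single 0 (complex_of_real (\<eta> \<bullet> y))"
proof -
  have s: "(\<Sum>k\<in>A. Poly_Mapping.single 0 (f k)) = Poly_Mapping.single 0 (\<Sum>k\<in>A. f k)"
    for f :: "'a \<Rightarrow> complex" and A
    by (induction A rule: infinite_finite_induct) (simp_all add: single_add)
  have "dderiv \<eta> (linear_form y) =
      (\<Sum>k\<in>UNIV. cpoly_scale (complex_of_real (y $ k)) (dderiv \<eta> (cpoly_var k)))"
    unfolding linear_form_eq [of y] by (simp only: diff_op_sum_right diff_op_scale_right)
  also have "\<dots> = Poly_Mapping.single 0 (\<Sum>k\<in>UNIV. complex_of_real (y $ k * \<eta> $ k))"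
    by (simp only: dderiv_var) (simp add: cpoly_scale_def mult_single s)
  finally show ?thesis
    by (simp add: inner_vec_def mult.commute)
qed

lemma dderiv_mult_linear_form:
  "dderiv \<eta> (linear_form y * q) =
     linear_form y * dderiv \<eta> q + cpoly_scale (complex_of_real (\<eta> \<bullet> y)) q"
  by (simp add: dderiv_mult dderiv_linear_form cpoly_scale_def)

lemma dderiv_add_vector: "dderiv (a + b) p = dderiv a p + dderiv b p"
  by (simp add: linear_form_add diff_op_add_left)

lemma dderiv_scaleR: "dderiv (c *\<^sub>R a) p = cpoly_scale (complex_of_real c) (dderiv a p)"
  by (simp add: linear_form_scaleR cpoly_scale_def diff_op_mult diff_op_single)

lemma funpow_dderiv_0 [simp]: "(dderiv \<eta> ^^ N) 0 = 0"
  by (induction N) simp_all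

lemma funpow_dderiv_add: "(dderiv \<eta> ^^ N) (p + q) = (dderiv \<eta> ^^ N) p + (dderiv \<eta> ^^ N) q"
  by (simp add: diff_op_add_right flip: diff_op_linear_form_power)

lemma funpow_dderiv_scale:
  "(dderiv \<eta> ^^ N) (cpoly_scale c p) = cpoly_scale c ((dderiv \<eta> ^^ N) p)"
  by (simp add: diff_op_scale_right flip: diff_op_linear_form_power)

lemma funpow_dderiv_mono:
  assumes "(dderiv \<eta> ^^ M) p = 0" "M \<le> N"
  shows "(dderiv \<eta> ^^ N) p = 0"
proof -
  have "(dderiv \<eta> ^^ N) p = (dderiv \<eta> ^^ (N - M)) ((dderiv \<eta> ^^ M) p)"
    using assms(2) funpow_add [of "N - M" M "dderiv \<eta>"] by simp
  with assms show ?thesis by simp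
qed

text \<open>This is the Leibniz rule; only two terms survive because the second derivative of a
  linear form vanishes.\<close>

lemma funpow_dderiv_mult_linear_form:
  "(dderiv \<eta> ^^ Suc N) (linear_form y * q) =
     linear_form y * (dderiv \<eta> ^^ Suc N) q +
     cpoly_scale (of_nat (Suc N) * complex_of_real (\<eta> \<bullet> y)) ((dderiv \<eta> ^^ N) q)"
proof (induction N)
  case 0
  show ?case by (simp add: dderiv_mult_linear_form)
next
  case (Suc N)
  have "(dderiv \<eta> ^^ Suc (Suc N)) (linear_form y * q) =
      dderiv \<eta> ((dderiv \<eta> ^^ Suc N) (linear_form y * q))" by simp
  also have "\<dots> = dderiv \<eta> (linear_form y * (dderiv \<eta> ^^ Suc N) q) +
     cpoly_scale (of_nat (Suc N) * complex_of_real (\<eta> \<bullet> y)) ((dderiv \<eta> ^^ Suc N) q)"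
    unfolding Suc diff_op_add_right diff_op_scale_right by simp
  also have "\<dots> = linear_form y * (dderiv \<eta> ^^ Suc (Suc N)) q +
     (cpoly_scale (complex_of_real (\<eta> \<bullet> y)) ((dderiv \<eta> ^^ Suc N) q) +
     cpoly_scale (of_nat (Suc N) * complex_of_real (\<eta> \<bullet> y)) ((dderiv \<eta> ^^ Suc N) q))"
    by (simp only: dderiv_mult_linear_form funpow.simps o_apply add.assoc)
  also have "cpoly_scale (complex_of_real (\<eta> \<bullet> y)) ((dderiv \<eta> ^^ Suc N) q) +
     cpoly_scale (of_nat (Suc N) * complex_of_real (\<eta> \<bullet> y)) ((dderiv \<eta> ^^ Suc N) q) =
     cpoly_scale (of_nat (Suc (Suc N)) * complex_of_real (\<eta> \<bullet> y)) ((dderiv \<eta> ^^ Suc N) q)"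
    unfolding cpoly.scale_left_distrib [symmetric] by (simp add: algebra_simps)
  finally show ?case .
qed

text \<open>Stands in for a degree bound: multiplying by a variable raises the order needed by at
  most one.\<close>

lemma dderiv_nilpotent: "\<exists>N. (dderiv \<eta> ^^ N) p = 0"
proof (induction p rule: cpoly_induct)
  case (const c)
  show ?case by (rule exI [of _ 1]) simp
next
  case (add p q)
  then obtain M N where "(dderiv \<eta> ^^ M) p = 0" "(dderiv \<eta> ^^ N) q = 0" by blast
  then have "(dderiv \<eta> ^^ (max M N)) p = 0" "(dderiv \<eta> ^^ (max M N)) q = 0"
    using funpow_dderiv_mono max.cobounded1 max.cobounded2 by blast+
  then have "(dderiv \<eta> ^^ (max M N)) (p + q) = 0"
    by (simp add: funpow_dderiv_add)
  then show ?case by blast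
next
  case (var p k)
  then obtain N where N: "(dderiv \<eta> ^^ N) p = 0" by blast
  with N funpow_dderiv_mult_linear_form [of N \<eta> "axis k 1" p]
  have "(dderiv \<eta> ^^ Suc N) (p * cpoly_var k) = 0"
    unfolding cpoly_var_eq_linear_form by (simp add: mult.commute)
  then show ?case by blast
qed

text \<open>If \<open>N > 0\<close> is minimal with \<open>dderiv \<eta> ^^ N\<close> killing \<open>q\<close>, then the \<open>N\<close>-th derivative of
  \<open>linear_form y * q\<close> is a nonzero multiple of the \<open>N - 1\<close>-st derivative of \<open>q\<close>.\<close>

lemma funpow_dderiv_cancel_transversal:
  assumes "(dderiv \<eta> ^^ Suc M) (linear_form y * q) = 0" and "\<eta> \<bullet> y \<noteq> 0"
  shows "(dderiv \<eta> ^^ M) q = 0"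
proof (rule ccontr)
  assume nz: "(dderiv \<eta> ^^ M) q \<noteq> 0"
  define N where "N = (LEAST N. (dderiv \<eta> ^^ N) q = 0)"
  have N: "(dderiv \<eta> ^^ N) q = 0"
    unfolding N_def using dderiv_nilpotent by (rule LeastI_ex)
  have "M < N"
    using N nz funpow_dderiv_mono not_le by blast
  then obtain K where K: "N = Suc K" "M \<le> K"
    by (cases N) auto
  have "(dderiv \<eta> ^^ K) q \<noteq> 0"
    using not_less_Least [of K "\<lambda>N. (dderiv \<eta> ^^ N) q = 0"] K N_def by auto
  moreover have "(dderiv \<eta> ^^ Suc K) (linear_form y * q) = 0"
    using funpow_dderiv_mono [OF assms(1)] K(2) by blast
  ultimately show False
    using funpow_dderiv_mult_linear_form [of K \<eta> y q] N assms(2) by (simp add: K(1) del: of_nat_Suc)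
qed

text \<open>The transversal case of order 0, with \<open>y\<close> itself as direction, since
  \<open>y \<bullet> y\<close> is nonzero.\<close>

lemma linear_form_mult_eq_0:
  assumes "linear_form y * q = 0" and "y \<noteq> 0"
  shows "q = 0"
  using funpow_dderiv_cancel_transversal [of 0 y y q] assms by simp

text \<open>A tangential derivative treats the linear form as a constant, which can then be
  cancelled.\<close>

lemma funpow_dderiv_cancel_tangential:
  assumes "(dderiv \<eta> ^^ M) (linear_form y * q) = 0" and "\<eta> \<bullet> y = 0" and "y \<noteq> 0"
  shows "(dderiv \<eta> ^^ M) q = 0"
proof -
  have "(dderiv \<eta> ^^ M) (linear_form y * q) = linear_form y * (dderiv \<eta> ^^ M) q"
    using assms(2) funpow_dderiv_mult_linear_form [of _ \<eta> y q] by (cases M) auto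
  with assms(1,3) show ?thesis
    using linear_form_mult_eq_0 by metis
qed

subsection \<open>Substitution homomorphisms\<close>

text \<open>Covers two uses at once: substituting polynomials for the variables, and evaluating at
  complex numbers.\<close>

locale coeff_hom =
  fixes \<phi> :: "complex \<Rightarrow> 'a::comm_ring_1"
  assumes coeff_add: "\<phi> (c + d) = \<phi> c + \<phi> d"
    and coeff_mult: "\<phi> (c * d) = \<phi> c * \<phi> d"
    and coeff_one: "\<phi> 1 = 1"
begin

definition insertion :: "('n::finite \<Rightarrow> 'a) \<Rightarrow> 'n cpoly \<Rightarrow> 'a" where
  "insertion v p =
     (\<Sum>m\<in>Poly_Mapping.keys p.
        \<phi> (Poly_Mapping.lookup p m) * (\<Prod>k\<in>UNIV. v k ^ Poly_Mapping.lookup m k))"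

lemma coeff_zero: "\<phi> 0 = 0"
  using coeff_add [of 0 0] by simp

lemma insertion_superset:
  assumes "finite S" "Poly_Mapping.keys p \<subseteq> S"
  shows "insertion v p =
    (\<Sum>m\<in>S. \<phi> (Poly_Mapping.lookup p m) * (\<Prod>k\<in>UNIV. v k ^ Poly_Mapping.lookup m k))"
  unfolding insertion_def
  by (rule sum.mono_neutral_left) (use assms in \<open>auto simp: in_keys_iff coeff_zero\<close>)

lemma insertion_single:
  "insertion v (Poly_Mapping.single m c) = \<phi> c * (\<Prod>k\<in>UNIV. v k ^ Poly_Mapping.lookup m k)"
  by (subst insertion_superset [of "{m}"]) auto

lemma insertion_const: "insertion v (Poly_Mapping.single 0 c) = \<phi> c"
  by (simp add: insertion_single)

lemma insertion_var: "insertion v (cpoly_var k) = v k"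
proof -
  have "(\<Prod>j\<in>UNIV. v j ^ Poly_Mapping.lookup (Poly_Mapping.single k 1) j) =
      (\<Prod>j\<in>UNIV. if j = k then v k else 1)"
    by (rule prod.cong) (auto simp: lookup_single)
  then show ?thesis by (simp add: insertion_single coeff_one)
qed

lemma insertion_add: "insertion v (p + q) = insertion v p + insertion v q"
proof -
  let ?S = "Poly_Mapping.keys p \<union> Poly_Mapping.keys q"
  have "finite ?S" "Poly_Mapping.keys (p + q) \<subseteq> ?S"
    using keys_add [of p q] by auto
  then show ?thesis
    by (simp add: insertion_superset [of ?S] lookup_add coeff_add distrib_right sum.distrib)
qed

lemma insertion_mult: "insertion v (p * q) = insertion v p * insertion v q"
proof (induction p rule: poly_mapping_add_single_induct)
  case (add p p')
  then show ?case by (simp add: insertion_add distrib_right)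
next
  case (single m c)
  show ?case
  proof (induction q rule: poly_mapping_add_single_induct)
    case (add q q')
    then show ?case by (simp add: insertion_add distrib_left)
  next
    case (single n d)
    then show ?case
      by (simp add: mult_single insertion_single lookup_add power_add prod.distrib coeff_mult mult_ac)
  qed
qed

lemma insertion_scale: "insertion v (cpoly_scale c p) = \<phi> c * insertion v p"
  by (simp add: cpoly_scale_def insertion_mult insertion_const)

lemma insertion_0 [simp]: "insertion v 0 = 0"
  by (simp add: insertion_def)

lemma insertion_1 [simp]: "insertion v 1 = 1"
  using insertion_const [of v 1] by (simp add: coeff_one)

lemma insertion_diff: "insertion v (p - q) = insertion v p - insertion v q"
  using insertion_add [of v "p - q" q] by simp

lemma insertion_sum: "insertion v (\<Sum>a\<in>A. f a) = (\<Sum>a\<in>A. insertion v (f a))"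
  by (induction A rule: infinite_finite_induct) (simp_all add: insertion_add)

lemma insertion_prod: "insertion v (\<Prod>a\<in>A. f a) = (\<Prod>a\<in>A. insertion v (f a))"
  by (induction A rule: infinite_finite_induct) (simp_all add: insertion_mult)

lemma insertion_power: "insertion v (p ^ N) = insertion v p ^ N"
  by (induction N) (simp_all add: insertion_mult)

end

interpretation subst: coeff_hom "Poly_Mapping.single 0 :: complex \<Rightarrow> 'n cpoly"
  by unfold_locales (simp_all add: single_add mult_single)

text \<open>For a linear map \<open>L\<close> this is composition with the adjoint of \<open>L\<close>: it maps the form
  \<open>t \<mapsto> y \<bullet> t\<close> to \<open>t \<mapsto> L y \<bullet> t\<close>.\<close>

definition pull :: "(real ^ 'n \<Rightarrow> real ^ 'n) \<Rightarrow> 'n::finite cpoly \<Rightarrow> 'n cpoly" where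
  "pull L = subst.insertion (\<lambda>k. linear_form (L (axis k 1)))"

lemma pull_linear_form:
  assumes "linear L"
  shows "pull L (linear_form y) = linear_form (L y)"
proof -
  have sum: "linear_form (\<Sum>k\<in>A. f k) = (\<Sum>k\<in>A. linear_form (f k))" for f :: "'a \<Rightarrow> real ^ 'a" and A
    by (induction A rule: infinite_finite_induct) (simp_all add: linear_form_add)
  have "pull L (linear_form y) =
      (\<Sum>k\<in>UNIV. cpoly_scale (complex_of_real (y $ k)) (linear_form (L (axis k 1))))"
    unfolding pull_def linear_form_eq [of y]
    by (simp only: subst.insertion_sum subst.insertion_mult subst.insertion_const
        subst.insertion_var cpoly_scale_def)
  also have "\<dots> = linear_form (L (\<Sum>k\<in>UNIV. (y $ k) *\<^sub>R axis k 1))"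
    using assms by (simp add: linear_sum linear_cmul sum linear_form_scaleR)
  also have "(\<Sum>k\<in>UNIV. (y $ k) *\<^sub>R axis k 1) = y"
    using basis_expansion [of y] by (simp add: scalar_mult_eq_scaleR)
  finally show ?thesis .
qed

text \<open>Chain rule, with \<open>\<eta>'\<close> the adjoint of \<open>L\<close> applied to
  \<open>\<eta>\<close>. As \<open>pull L\<close> is a homomorphism, variables suffice.\<close>

lemma dderiv_pull:
  assumes "\<And>y. \<eta>' \<bullet> y = \<eta> \<bullet> L y"
  shows "dderiv \<eta> (pull L p) = pull L (dderiv \<eta>' p)"
proof (induction p rule: cpoly_induct)
  case (const c)
  show ?case by (simp add: pull_def subst.insertion_const)
next
  case (add p q)
  then show ?case by (simp add: pull_def subst.insertion_add diff_op_add_right)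
next
  case (var p k)
  have "\<eta>' $ k = \<eta> \<bullet> L (axis k 1)"
    using assms [of "axis k 1"] by (simp add: inner_axis)
  with var show ?case
    unfolding dderiv_mult dderiv_var pull_def subst.insertion_mult subst.insertion_var
      subst.insertion_add subst.insertion_const
    by (simp add: dderiv_linear_form)
qed

lemma funpow_dderiv_pull:
  assumes "\<And>y. \<eta>' \<bullet> y = \<eta> \<bullet> L y"
  shows "(dderiv \<eta> ^^ N) (pull L p) = pull L ((dderiv \<eta>' ^^ N) p)"
  by (induction N) (simp_all add: dderiv_pull [OF assms])

subsection \<open>Projection along a vector\<close>

definition proj_along :: "real ^ 'n::finite \<Rightarrow> real ^ 'n \<Rightarrow> real ^ 'n" where
  "proj_along a y = y - ((y \<bullet> a) / (a \<bullet> a)) *\<^sub>R a"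

lemma linear_proj_along: "linear (proj_along a)"
  by (rule linearI)
    (simp_all add: proj_along_def inner_add_left add_divide_distrib algebra_simps)

lemma proj_along_orthogonal: "a \<noteq> 0 \<Longrightarrow> proj_along a y \<bullet> a = 0"
  by (simp add: proj_along_def inner_diff_left)

lemma proj_along_selfadjoint: "proj_along a y \<bullet> z = y \<bullet> proj_along a z"
  by (simp add: proj_along_def inner_diff_left inner_diff_right inner_commute)

text \<open>Modulo \<open>linear_form a\<close> every variable equals its substituted image, hence
  so does every polynomial. Thus a polynomial vanishing on the complement of \<open>a\<close> is
  divisible by the form.\<close>

lemma linear_form_dvd_diff_pull: "linear_form a dvd p - pull (proj_along a) p"
proof (induction p rule: cpoly_induct)
  case (const c)
  show ?case by (simp add: pull_def subst.insertion_const)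
next
  case (add p q)
  from dvd_add [OF this] show ?case by (simp add: pull_def subst.insertion_add algebra_simps)
next
  case (var p k)
  let ?e = "axis k 1 :: real ^ 'a" and ?P = "proj_along a"
  have "cpoly_var k - linear_form (?P ?e) = linear_form (((?e \<bullet> a) / (a \<bullet> a)) *\<^sub>R a)"
    using linear_form_add [of "?P ?e" "((?e \<bullet> a) / (a \<bullet> a)) *\<^sub>R a"]
    unfolding cpoly_var_eq_linear_form by (simp add: proj_along_def)
  then have "linear_form a dvd cpoly_var k - linear_form (?P ?e)"
    by (simp add: linear_form_scaleR cpoly_scale_def)
  then have "linear_form a dvd
      (p - pull ?P p) * cpoly_var k + pull ?P p * (cpoly_var k - linear_form (?P ?e))"
    using var by (simp only: dvd_add dvd_mult dvd_mult2)
  also have "\<dots> = p * cpoly_var k - pull ?P (p * cpoly_var k)"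
    unfolding pull_def subst.insertion_mult subst.insertion_var by (simp add: algebra_simps)
  finally show ?case .
qed

text \<open>Together with \<open>a\<close>, the projected vectors span the same space as the
  original ones, and they are orthogonal to \<open>a\<close>. This translates the dimension
  condition under contraction.\<close>

lemma dim_insert_proj_along:
  fixes a :: "real ^ 'n"
  assumes "a \<noteq> 0"
  shows "dim (insert a S) = Suc (dim (proj_along a ` S))"
proof -
  let ?P = "proj_along a"
  have a: "a \<in> span (insert a T)" for T
    by (simp add: span_base)
  have "?P y \<in> span (insert a S)" if "y \<in> S" for y
    unfolding proj_along_def using that a by (intro span_diff span_scale) (auto intro: span_base)
  moreover have "y \<in> span (insert a (?P ` S))" if "y \<in> S" for y
  proof -
    have "y = ?P y + ((y \<bullet> a) / (a \<bullet> a)) *\<^sub>R a"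
      by (simp add: proj_along_def)
    moreover have "?P y + ((y \<bullet> a) / (a \<bullet> a)) *\<^sub>R a \<in> span (insert a (?P ` S))"
      using that a by (intro span_add span_scale) (auto intro: span_base)
    ultimately show ?thesis by simp
  qed
  ultimately have "span (insert a S) = span (insert a (?P ` S))"
    using a by (intro subset_antisym span_minimal) auto
  then have "dim (insert a S) = dim (insert a (?P ` S))"
    by (metis dim_span)
  moreover have "a \<notin> span (?P ` S)"
  proof
    assume "a \<in> span (?P ` S)"
    then have "orthogonal a a"
      by (rule orthogonal_to_span)
        (use proj_along_orthogonal [OF assms] in \<open>auto simp: orthogonal_def inner_commute\<close>)
    with assms show False by (simp add: orthogonal_self)
  qed
  ultimately show ?thesis
    by (simp add: dim_insert)
qed

subsection \<open>The kernel of the facet conditions\<close>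

text \<open>Neither spanning nor nonzero vectors are assumed here, so the induction can delete and
  contract freely. A direction orthogonal to all vectors satisfies the dimension condition, so
  the polynomials in the kernel are constant along the orthogonal complement of the span.\<close>

definition facet_kernel :: "'i set \<Rightarrow> ('i \<Rightarrow> real ^ 'n::finite) \<Rightarrow> 'n cpoly set" where
  "facet_kernel I x = {p. \<forall>\<eta>. dim (x ` I) \<le> Suc (dim (x ` {i\<in>I. \<eta> \<bullet> x i = 0})) \<longrightarrow>
     (dderiv \<eta> ^^ Suc (card {i\<in>I. \<eta> \<bullet> x i \<noteq> 0})) p = 0}"

lemma facet_kernelD:
  assumes "p \<in> facet_kernel I x" "dim (x ` I) \<le> Suc (dim (x ` {i\<in>I. \<eta> \<bullet> x i = 0}))"
  shows "(dderiv \<eta> ^^ Suc (card {i\<in>I. \<eta> \<bullet> x i \<noteq> 0})) p = 0"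
  using assms unfolding facet_kernel_def by blast

lemma subspace_funpow_dderiv_kernel: "cpoly.subspace {p. (dderiv \<eta> ^^ N) p = 0}"
  by (simp add: cpoly.subspace_def funpow_dderiv_add funpow_dderiv_scale)

lemma subspace_facet_kernel: "cpoly.subspace (facet_kernel I x)"
  unfolding cpoly.subspace_def facet_kernel_def
  by (simp add: funpow_dderiv_add funpow_dderiv_scale del: funpow.simps)

text \<open>Each transversal factor can absorb one derivative, and tangential factors absorb none;
  one further derivative gives zero.\<close>

lemma funpow_dderiv_prod_linear_form:
  assumes "finite Y"
  shows "(dderiv \<eta> ^^ Suc (card {i\<in>Y. \<eta> \<bullet> x i \<noteq> 0})) (\<Prod>i\<in>Y. linear_form (x i)) = 0"
  using assms
proof (induction Y rule: finite_induct)
  case empty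
  show ?case by simp
next
  case (insert j Y)
  let ?q = "\<Prod>i\<in>Y. linear_form (x i)" and ?N = "card {i\<in>Y. \<eta> \<bullet> x i \<noteq> 0}"
  have q: "(dderiv \<eta> ^^ Suc N) ?q = 0" if "?N \<le> N" for N
    using funpow_dderiv_mono [OF insert.IH] that by blast
  show ?case
  proof (cases "\<eta> \<bullet> x j = 0")
    case True
    then have "{i \<in> insert j Y. \<eta> \<bullet> x i \<noteq> 0} = {i\<in>Y. \<eta> \<bullet> x i \<noteq> 0}"
      by auto
    with insert.hyps True q [of ?N] show ?thesis
      by (simp add: funpow_dderiv_mult_linear_form del: funpow.simps)
  next
    case False
    then have "{i \<in> insert j Y. \<eta> \<bullet> x i \<noteq> 0} = insert j {i\<in>Y. \<eta> \<bullet> x i \<noteq> 0}"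
      by auto
    with insert.hyps have "card {i \<in> insert j Y. \<eta> \<bullet> x i \<noteq> 0} = Suc ?N"
      by simp
    with insert.hyps q [of ?N] q [of "Suc ?N"] show ?thesis
      by (simp add: funpow_dderiv_mult_linear_form del: funpow.simps)
  qed
qed

lemma funpow_dderiv_P_plus:
  assumes "finite I" "p \<in> P_plus I x"
  shows "(dderiv \<eta> ^^ Suc (card {i\<in>I. \<eta> \<bullet> x i \<noteq> 0})) p = 0"
proof -
  have "(dderiv \<eta> ^^ Suc (card {i\<in>I. \<eta> \<bullet> x i \<noteq> 0})) (\<Prod>i\<in>Y. linear_form (x i)) = 0"
    if "Y \<subseteq> I" for Y
  proof (rule funpow_dderiv_mono [OF funpow_dderiv_prod_linear_form])
    show "finite Y"
      using that assms(1) finite_subset by blast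
    show "Suc (card {i\<in>Y. \<eta> \<bullet> x i \<noteq> 0}) \<le> Suc (card {i\<in>I. \<eta> \<bullet> x i \<noteq> 0})"
      using that assms(1) by (auto intro!: card_mono)
  qed
  then have "P_plus I x \<subseteq> {p. (dderiv \<eta> ^^ Suc (card {i\<in>I. \<eta> \<bullet> x i \<noteq> 0})) p = 0}"
    unfolding P_plus_def
    by (intro cpoly.span_minimal subspace_funpow_dderiv_kernel) blast
  with assms(2) show ?thesis by blast
qed

section \<open>Inclusion, multiplication and substitution for \<open>P_plus\<close>\<close>

lemma P_plus_subset_facet_kernel: "finite I \<Longrightarrow> P_plus I x \<subseteq> facet_kernel I x"
  unfolding facet_kernel_def using funpow_dderiv_P_plus by blast

lemma P_plus_mono: "J \<subseteq> I \<Longrightarrow> P_plus J x \<subseteq> P_plus I x"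
  unfolding P_plus_def by (rule cpoly.span_mono) auto

lemma linear_form_mult_P_plus:
  assumes "i \<notin> J" "finite J" "q \<in> P_plus J x"
  shows "linear_form (x i) * q \<in> P_plus (insert i J) x"
proof -
  let ?S = "{q. linear_form (x i) * q \<in> P_plus (insert i J) x}"
  have "P_plus J x \<subseteq> ?S"
    unfolding P_plus_def [of J]
  proof (rule cpoly.span_minimal)
    show "cpoly.subspace ?S"
      unfolding P_plus_def cpoly.subspace_def
      by (simp add: cpoly.span_add cpoly.span_scale cpoly.span_zero distrib_left
          cpoly_scale_mult_right)
    show "{\<Prod>i\<in>Y. linear_form (x i) |Y. Y \<subseteq> J} \<subseteq> ?S"
    proof clarify
      fix Y assume "Y \<subseteq> J"
      with assms have "linear_form (x i) * (\<Prod>i\<in>Y. linear_form (x i)) =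
          (\<Prod>i\<in>insert i Y. linear_form (x i))"
        by (subst prod.insert) (auto intro: finite_subset)
      moreover have "insert i Y \<subseteq> insert i J"
        using \<open>Y \<subseteq> J\<close> by auto
      ultimately show "linear_form (x i) * (\<Prod>i\<in>Y. linear_form (x i)) \<in> P_plus (insert i J) x"
        unfolding P_plus_def by (auto intro!: cpoly.span_base)
    qed
  qed
  with assms(3) show ?thesis by blast
qed

text \<open>Used to lift from a contraction: a product of projected forms is the image of the
  product of the original forms.\<close>

lemma P_plus_pull:
  assumes "linear L"
  shows "P_plus J (\<lambda>i. L (x i)) \<subseteq> pull L ` P_plus J x"
  unfolding P_plus_def [of J "\<lambda>i. L (x i)"]
proof (rule cpoly.span_minimal)
  have P: "cpoly.subspace (P_plus J x)"
    unfolding P_plus_def by (rule cpoly.subspace_span)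
  show "cpoly.subspace (pull L ` P_plus J x)"
    unfolding cpoly.subspace_def
  proof (intro conjI ballI allI)
    have "pull L 0 = 0" by (simp add: pull_def)
    then show "0 \<in> pull L ` P_plus J x"
      using cpoly.subspace_0 [OF P] by (metis imageI)
  next
    fix p q assume "p \<in> pull L ` P_plus J x" "q \<in> pull L ` P_plus J x"
    then show "p + q \<in> pull L ` P_plus J x"
      using cpoly.subspace_add [OF P] by (auto simp: pull_def simp flip: subst.insertion_add)
  next
    fix c p assume "p \<in> pull L ` P_plus J x"
    moreover have "cpoly_scale c (pull L q) = pull L (cpoly_scale c q)" for q
      by (simp add: pull_def subst.insertion_scale cpoly_scale_def [of _ "subst.insertion _ _"])
    ultimately show "cpoly_scale c p \<in> pull L ` P_plus J x"
      using cpoly.subspace_scale [OF P] by auto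
  qed
  show "{\<Prod>i\<in>Y. linear_form (L (x i)) |Y. Y \<subseteq> J} \<subseteq> pull L ` P_plus J x"
  proof clarify
    fix Y assume "Y \<subseteq> J"
    have "(\<Prod>i\<in>Y. linear_form (L (x i))) = pull L (\<Prod>i\<in>Y. linear_form (x i))"
      unfolding pull_linear_form [OF assms, symmetric] by (simp add: pull_def subst.insertion_prod)
    moreover have "(\<Prod>i\<in>Y. linear_form (x i)) \<in> P_plus J x"
      unfolding P_plus_def using \<open>Y \<subseteq> J\<close> by (auto intro: cpoly.span_base)
    ultimately show "(\<Prod>i\<in>Y. linear_form (L (x i))) \<in> pull L ` P_plus J x"
      by blast
  qed
qed

section \<open>Contraction and deletion in the facet kernel\<close>

lemma funpow_dderiv_shift:
  assumes "dderiv \<zeta> q = 0"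
  shows "(dderiv (\<eta> + c *\<^sub>R \<zeta>) ^^ N) q = (dderiv \<eta> ^^ N) q"
proof (induction N)
  case (Suc N)
  have "dderiv \<zeta> ((dderiv \<eta> ^^ N) q) = (dderiv \<eta> ^^ N) (dderiv \<zeta> q)"
    unfolding diff_op_linear_form_power [symmetric] diff_op_mult [symmetric]
    by (simp add: mult.commute)
  with assms Suc show ?case
    by (simp add: dderiv_add_vector dderiv_scaleR)
qed simp

text \<open>Derivatives along \<open>\<eta>\<close> of the pulled polynomial come from derivatives
  along the projection \<open>\<zeta>\<close> of \<open>\<eta>\<close>. As \<open>\<zeta>\<close> is
  orthogonal to \<open>x i\<close>, this vector adds one to both dimensions and nothing to the
  order.\<close>

lemma facet_kernel_contract:
  assumes "p \<in> facet_kernel (insert i J) x" "x i \<noteq> 0"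
  shows "pull (proj_along (x i)) p \<in> facet_kernel J (\<lambda>j. proj_along (x i) (x j))"
  unfolding facet_kernel_def
proof (intro CollectI allI impI)
  fix \<eta>
  let ?P = "proj_along (x i)"
  assume dim: "dim ((\<lambda>j. ?P (x j)) ` J) \<le> Suc (dim ((\<lambda>j. ?P (x j)) ` {j\<in>J. \<eta> \<bullet> ?P (x j) = 0}))"
  define \<zeta> where "\<zeta> = ?P \<eta>"
  have \<zeta>: "\<zeta> \<bullet> y = \<eta> \<bullet> ?P y" for y
    unfolding \<zeta>_def by (rule proj_along_selfadjoint)
  have \<zeta>i: "\<zeta> \<bullet> x i = 0"
    unfolding \<zeta>_def using assms(2) by (rule proj_along_orthogonal)
  have "x ` {j\<in>insert i J. \<zeta> \<bullet> x j = 0} = insert (x i) (x ` {j\<in>J. \<eta> \<bullet> ?P (x j) = 0})"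
    using \<zeta>i by (auto simp: \<zeta>)
  then have "dim (x ` insert i J) \<le> Suc (dim (x ` {j\<in>insert i J. \<zeta> \<bullet> x j = 0}))"
    using dim by (simp add: dim_insert_proj_along [OF assms(2)] image_image)
  from facet_kernelD [OF assms(1) this]
  have "(dderiv \<zeta> ^^ Suc (card {j\<in>insert i J. \<zeta> \<bullet> x j \<noteq> 0})) p = 0" .
  moreover have "{j\<in>insert i J. \<zeta> \<bullet> x j \<noteq> 0} = {j\<in>J. \<eta> \<bullet> ?P (x j) \<noteq> 0}"
    using \<zeta>i by (auto simp: \<zeta>)
  ultimately show "(dderiv \<eta> ^^ Suc (card {j\<in>J. \<eta> \<bullet> ?P (x j) \<noteq> 0})) (pull ?P p) = 0"
    unfolding funpow_dderiv_pull [OF \<zeta>] by (simp add: pull_def del: funpow.simps)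
qed

text \<open>If \<open>x i\<close> lies in the span of the others, directions admissible for
  \<open>J\<close> stay admissible for the larger family. Otherwise \<open>\<eta>\<close> is first
  tilted to become orthogonal to \<open>x i\<close>, along a direction whose derivative kills
  \<open>q\<close>.\<close>

lemma facet_kernel_delete:
  assumes r: "linear_form (x i) * q \<in> facet_kernel (insert i J) x"
    and i: "x i \<noteq> 0" "i \<notin> J" "finite J"
  shows "q \<in> facet_kernel J x"
  unfolding facet_kernel_def
proof (intro CollectI allI impI)
  fix \<eta>
  assume dim: "dim (x ` J) \<le> Suc (dim (x ` {j\<in>J. \<eta> \<bullet> x j = 0}))"
  \<comment> \<open>A transversal \<open>x i\<close> raises the order by one, which its factor
    absorbs; a tangential factor is cancelled outright.\<close>
  have main: "(dderiv \<eta> ^^ Suc (card {j\<in>J. \<eta> \<bullet> x j \<noteq> 0})) q = 0"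
    if d: "dim (x ` insert i J) \<le> Suc (dim (x ` {j\<in>insert i J. \<eta> \<bullet> x j = 0}))" for \<eta>
  proof (cases "\<eta> \<bullet> x i = 0")
    case True
    then have "{j\<in>insert i J. \<eta> \<bullet> x j \<noteq> 0} = {j\<in>J. \<eta> \<bullet> x j \<noteq> 0}"
      by auto
    with facet_kernelD [OF r d]
    have "(dderiv \<eta> ^^ Suc (card {j\<in>J. \<eta> \<bullet> x j \<noteq> 0})) (linear_form (x i) * q) = 0"
      by (simp only:)
    then show ?thesis
      using True i(1) by (rule funpow_dderiv_cancel_tangential)
  next
    case False
    then have "{j\<in>insert i J. \<eta> \<bullet> x j \<noteq> 0} = insert i {j\<in>J. \<eta> \<bullet> x j \<noteq> 0}"
      by auto
    with i have "card {j\<in>insert i J. \<eta> \<bullet> x j \<noteq> 0} = Suc (card {j\<in>J. \<eta> \<bullet> x j \<noteq> 0})"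
      by simp
    with facet_kernelD [OF r d]
    have "(dderiv \<eta> ^^ Suc (Suc (card {j\<in>J. \<eta> \<bullet> x j \<noteq> 0}))) (linear_form (x i) * q) = 0"
      by (simp only:)
    then show ?thesis
      using False by (rule funpow_dderiv_cancel_transversal)
  qed
  show "(dderiv \<eta> ^^ Suc (card {j\<in>J. \<eta> \<bullet> x j \<noteq> 0})) q = 0"
  proof (cases "x i \<in> span (x ` J)")
    case True
    then have "dim (x ` insert i J) = dim (x ` J)"
      by (simp add: dim_insert)
    moreover have "dim (x ` {j\<in>J. \<eta> \<bullet> x j = 0}) \<le> dim (x ` {j\<in>insert i J. \<eta> \<bullet> x j = 0})"
      by (rule dim_subset) auto
    ultimately show ?thesis
      using dim by (intro main) linarith
  next
    case False
    \<comment> \<open>Here \<open>x i\<close> raises both dimensions by one, so the condition for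
      \<open>J\<close> passes to the larger family.\<close>
    have perp: "(dderiv \<theta> ^^ Suc (card {j\<in>J. \<theta> \<bullet> x j \<noteq> 0})) q = 0"
      if d: "dim (x ` J) \<le> Suc (dim (x ` {j\<in>J. \<theta> \<bullet> x j = 0}))" and "\<theta> \<bullet> x i = 0" for \<theta>
    proof (rule main)
      have "x i \<notin> span (x ` {j\<in>J. \<theta> \<bullet> x j = 0})"
        using False span_mono [of "x ` {j\<in>J. \<theta> \<bullet> x j = 0}" "x ` J"] by auto
      moreover have "x ` {j\<in>insert i J. \<theta> \<bullet> x j = 0} = insert (x i) (x ` {j\<in>J. \<theta> \<bullet> x j = 0})"
        using that(2) by auto
      ultimately show "dim (x ` insert i J) \<le> Suc (dim (x ` {j\<in>insert i J. \<theta> \<bullet> x j = 0}))"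
        using False d by (simp add: dim_insert)
    qed
    obtain y \<zeta> where y\<zeta>: "y \<in> span (x ` J)" "\<And>w. w \<in> span (x ` J) \<Longrightarrow> orthogonal \<zeta> w" "x i = y + \<zeta>"
      using orthogonal_subspace_decomp_exists [of "x ` J" "x i"] by blast
    have \<zeta>J: "\<zeta> \<bullet> x j = 0" if "j \<in> J" for j
      using y\<zeta>(2) [of "x j"] that by (auto simp: orthogonal_def intro: span_base)
    have "\<zeta> \<noteq> 0"
      using y\<zeta> False by auto
    moreover have "\<zeta> \<bullet> x i = \<zeta> \<bullet> \<zeta>"
      using y\<zeta> by (simp add: orthogonal_def inner_add_right)
    ultimately have \<zeta>i: "\<zeta> \<bullet> x i \<noteq> 0"
      by simp
    \<comment> \<open>\<open>\<zeta>\<close> is orthogonal to all vectors of \<open>J\<close>, so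
      its condition is a first-order equation.\<close>
    have D\<zeta>: "dderiv \<zeta> q = 0"
    proof -
      have e: "{j\<in>insert i J. \<zeta> \<bullet> x j = 0} = J" "{j\<in>J. \<zeta> \<bullet> x j \<noteq> 0} = {}"
        using \<zeta>J \<zeta>i i by auto
      have "(dderiv \<zeta> ^^ Suc (card {j\<in>J. \<zeta> \<bullet> x j \<noteq> 0})) q = 0"
        by (rule main, unfold e) (simp add: dim_insert)
      then show ?thesis
        unfolding e by simp
    qed
    \<comment> \<open>Chosen to make \<open>\<theta>\<close> orthogonal to \<open>x i\<close>.
      Subtracting a multiple of \<open>\<zeta>\<close> changes neither the products with vectors of
      \<open>J\<close> nor the derivatives of \<open>q\<close>.\<close>
    define c where "c = (\<eta> \<bullet> x i) / (\<zeta> \<bullet> x i)"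
    define \<theta> where "\<theta> = \<eta> - c *\<^sub>R \<zeta>"
    have "\<theta> \<bullet> x i = 0"
      using \<zeta>i by (simp add: \<theta>_def c_def inner_diff_left)
    have \<theta>J: "\<theta> \<bullet> x j = \<eta> \<bullet> x j" if "j \<in> J" for j
      using \<zeta>J [OF that] by (simp add: \<theta>_def inner_diff_left)
    then have "{j\<in>J. \<theta> \<bullet> x j = 0} = {j\<in>J. \<eta> \<bullet> x j = 0}" "{j\<in>J. \<theta> \<bullet> x j \<noteq> 0} = {j\<in>J. \<eta> \<bullet> x j \<noteq> 0}"
      by auto
    with perp [of \<theta>] dim \<open>\<theta> \<bullet> x i = 0\<close>
    have "(dderiv \<theta> ^^ Suc (card {j\<in>J. \<eta> \<bullet> x j \<noteq> 0})) q = 0"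
      by (simp only:)
    then have "(dderiv (\<theta> + c *\<^sub>R \<zeta>) ^^ Suc (card {j\<in>J. \<eta> \<bullet> x j \<noteq> 0})) q = 0"
      by (simp only: funpow_dderiv_shift [OF D\<zeta>])
    moreover have "\<theta> + c *\<^sub>R \<zeta> = \<eta>"
      by (simp add: \<theta>_def)
    ultimately show ?thesis
      by (simp only:)
  qed
qed

section \<open>The induction placing the facet kernel inside \<open>P_plus\<close>\<close>

lemma constant_if_dderiv_0:
  assumes "\<And>\<eta>. dderiv \<eta> p = 0"
  shows "p = Poly_Mapping.single 0 (Poly_Mapping.lookup p 0)"
proof (rule poly_mapping_eqI)
  fix m
  show "Poly_Mapping.lookup p m = Poly_Mapping.lookup (Poly_Mapping.single 0 (Poly_Mapping.lookup p 0)) m"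
  proof (induction m rule: exponent_induct)
    case (Suc m k)
    have "dderiv (axis k 1) p = partial k p"
    proof -
      have "dderiv (axis k 1) p = (\<Sum>j\<in>UNIV. if j = k then partial k p else 0)"
        unfolding dderiv_eq by (rule sum.cong) (auto simp: axis_def)
      then show ?thesis by simp
    qed
    then have "Poly_Mapping.lookup (partial k p) m = 0"
      using assms by simp
    then have "Poly_Mapping.lookup p (m + Poly_Mapping.single k 1) = 0"
      unfolding lookup_partial by (simp del: of_nat_add of_nat_Suc)
    moreover have "Poly_Mapping.lookup (m + Poly_Mapping.single k 1) k \<noteq> 0"
      by (simp add: lookup_add)
    then have "m + Poly_Mapping.single k 1 \<noteq> 0"
      by (metis lookup_zero)
    ultimately show ?case
      by (simp add: lookup_single when_def)
  qed simp
qed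

lemma facet_kernel_subset_P_plus:
  assumes "finite I"
  shows "facet_kernel I x \<subseteq> P_plus I x"
  using assms
proof (induction I arbitrary: x rule: finite_induct)
  case empty
  show ?case
  proof
    fix p assume "p \<in> facet_kernel {} x"
    \<comment> \<open>For the empty family every direction is admissible and the order is 1.\<close>
    then have "dderiv \<eta> p = 0" for \<eta>
      unfolding facet_kernel_def by simp
    from constant_if_dderiv_0 [OF this] obtain c where "p = cpoly_scale c 1"
      by (auto simp: cpoly_scale_def)
    moreover have "cpoly_scale c 1 \<in> P_plus {} x"
      unfolding P_plus_def by (intro cpoly.span_scale cpoly.span_base) auto
    ultimately show "p \<in> P_plus {} x"
      by simp
  qed
next
  case (insert i J)
  show ?case
  proof
    fix p assume p: "p \<in> facet_kernel (insert i J) x"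
    show "p \<in> P_plus (insert i J) x"
    proof (cases "x i = 0")
      case True
      \<comment> \<open>A zero vector changes neither the dimensions nor the count of transversal
        vectors.\<close>
      have "x ` {j\<in>insert i J. \<eta> \<bullet> x j = 0} = insert 0 (x ` {j\<in>J. \<eta> \<bullet> x j = 0})"
        "{j\<in>insert i J. \<eta> \<bullet> x j \<noteq> 0} = {j\<in>J. \<eta> \<bullet> x j \<noteq> 0}" for \<eta>
        using True by auto
      then have "p \<in> facet_kernel J x"
        using p True unfolding facet_kernel_def by (simp add: dim_insert span_zero del: funpow.simps)
      then show ?thesis
        using insert.IH P_plus_mono [of J "insert i J" x] by blast
    next
      case False
      let ?P = "proj_along (x i)"
      \<comment> \<open>The induction hypothesis is applied to the projected family, and
        \<open>P_plus_pull\<close> lifts the result to the original forms.\<close>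
      have "pull ?P p \<in> pull ?P ` P_plus J x"
        using facet_kernel_contract [OF p False] insert.IH P_plus_pull [OF linear_proj_along] by blast
      then obtain g where g: "g \<in> P_plus J x" "pull ?P g = pull ?P p"
        by (metis imageE)
      have "pull ?P (p - g) = 0"
        using g by (simp add: pull_def subst.insertion_diff)
      then obtain q where q: "p - g = linear_form (x i) * q"
        using linear_form_dvd_diff_pull [of "x i" "p - g"] by (auto elim: dvdE)
      have g': "g \<in> P_plus (insert i J) x"
        using g P_plus_mono [of J "insert i J" x] by blast
      \<comment> \<open>The easy inclusion of \<open>P_plus\<close> in the kernel keeps the
        difference there, so that deletion applies to the quotient \<open>q\<close>.\<close>
      then have "p - g \<in> facet_kernel (insert i J) x"
        using p P_plus_subset_facet_kernel [of "insert i J" x] insert.hyps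
        by (intro cpoly.subspace_diff [OF subspace_facet_kernel]) auto
      then have "q \<in> facet_kernel J x"
        unfolding q by (rule facet_kernel_delete [where i = i and x = x, OF _ False insert.hyps(2,1)])
      then have "linear_form (x i) * q \<in> P_plus (insert i J) x"
        using insert by (intro linear_form_mult_P_plus) auto
      then have "g + linear_form (x i) * q \<in> P_plus (insert i J) x"
        using g' unfolding P_plus_def by (rule cpoly.span_add [rotated])
      then show ?thesis
        by (simp flip: q)
    qed
  qed
qed

subsection \<open>The kernel of the power ideal\<close>

text \<open>The component of \<open>y\<close> orthogonal to \<open>\<zeta>\<close> lies in the
  hyperplane, hence is orthogonal to \<open>y\<close> and therefore to itself.\<close>

lemma normal_proportional:
  fixes \<zeta> y :: "real ^ 'n"
  assumes "is_normal {h. \<zeta> \<bullet> h = 0} y"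
  shows "\<exists>c. \<zeta> = c *\<^sub>R y"
proof (cases "\<zeta> = 0")
  case False
  define w where "w = proj_along \<zeta> y"
  have w: "\<zeta> \<bullet> w = 0"
    using proj_along_orthogonal [OF False, of y] by (simp add: w_def inner_commute)
  then have "y \<bullet> w = 0"
    using assms by (auto simp: is_normal_def)
  with w have "w \<bullet> w = 0"
    by (subst w_def) (simp add: proj_along_def inner_diff_left)
  then have "y = ((y \<bullet> \<zeta>) / (\<zeta> \<bullet> \<zeta>)) *\<^sub>R \<zeta>"
    by (simp add: w_def proj_along_def)
  moreover have "y \<noteq> 0"
    using assms by (simp add: is_normal_def)
  ultimately have "\<zeta> = inverse ((y \<bullet> \<zeta>) / (\<zeta> \<bullet> \<zeta>)) *\<^sub>R y"
    by (metis scaleR_scaleR left_inverse scaleR_one scaleR_zero_left)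
  then show ?thesis ..
qed (auto intro: exI [of _ 0])

lemma ideal_kernel_I_plus:
  "ideal_kernel (I_plus I x \<eta>) =
     {p. \<forall>H\<in>facet_hyperplanes I x. (dderiv (\<eta> H) ^^ Suc (card {i\<in>I. x i \<notin> H})) p = 0}"
  unfolding I_plus_def ideal_kernel_span Suc_eq_plus1 diff_op_linear_form_power [symmetric]
  by auto

lemma funpow_dderiv_scaleR:
  "(dderiv (c *\<^sub>R a) ^^ N) p = cpoly_scale (complex_of_real c ^ N) ((dderiv a ^^ N) p)"
  by (induction N) (simp_all add: dderiv_scaleR diff_op_scale_right)

lemma P_plus_eq_ideal_kernel:
  fixes x :: "'i \<Rightarrow> real ^ 'n::finite"
  assumes fin: "finite I" and sp: "span (x ` I) = UNIV"
    and normal: "\<And>H. H \<in> facet_hyperplanes I x \<Longrightarrow> is_normal H (\<eta> H)"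
  shows "P_plus I x = ideal_kernel (I_plus I x \<eta>)"
proof
  show "P_plus I x \<subseteq> ideal_kernel (I_plus I x \<eta>)"
    unfolding ideal_kernel_I_plus
  proof (intro subsetI CollectI ballI)
    fix p H assume p: "p \<in> P_plus I x" and H: "H \<in> facet_hyperplanes I x"
    have "card {i\<in>I. \<eta> H \<bullet> x i \<noteq> 0} \<le> card {i\<in>I. x i \<notin> H}"
      using fin normal [OF H] by (intro card_mono) (auto simp: is_normal_def)
    then show "(dderiv (\<eta> H) ^^ Suc (card {i\<in>I. x i \<notin> H})) p = 0"
      using funpow_dderiv_P_plus [OF fin p] funpow_dderiv_mono Suc_le_mono by blast
  qed
  have "ideal_kernel (I_plus I x \<eta>) \<subseteq> facet_kernel I x"
    unfolding ideal_kernel_I_plus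
  proof
    fix p
    assume p: "p \<in> {p. \<forall>H\<in>facet_hyperplanes I x. (dderiv (\<eta> H) ^^ Suc (card {i\<in>I. x i \<notin> H})) p = 0}"
    have "(dderiv \<zeta> ^^ Suc (card {i\<in>I. \<zeta> \<bullet> x i \<noteq> 0})) p = 0"
      if d: "dim (x ` I) \<le> Suc (dim (x ` {i\<in>I. \<zeta> \<bullet> x i = 0}))" for \<zeta>
    proof (cases "\<zeta> = 0")
      \<comment> \<open>The zero direction always meets the dimension condition, but its derivative
        is the zero operator.\<close>
      case True
      then show ?thesis by (simp add: diff_op_def)
    next
      case False
      define H where "H = {h. \<zeta> \<bullet> h = 0}"
      have "dim (x ` I) = CARD('n)"
        using sp by (metis dim_span dim_UNIV DIM_cart DIM_real mult_1_right)
      moreover have dH: "dim H = CARD('n) - 1"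
        unfolding H_def using dim_hyperplane [OF False] by simp
      moreover have sH: "subspace H"
        unfolding H_def by (rule subspace_hyperplane)
      \<comment> \<open>The dimension condition forces the vectors lying in \<open>H\<close> to have
        its full dimension, so \<open>H\<close> is a facet hyperplane.\<close>
      moreover have "span (x ` {i\<in>I. x i \<in> H}) = span H"
        using d dH \<open>dim (x ` I) = CARD('n)\<close> by (intro dim_eq_span) (auto simp: H_def)
      ultimately have H: "H \<in> facet_hyperplanes I x"
        by (simp add: facet_hyperplanes_def span_eq_iff)
      then have "(dderiv (\<eta> H) ^^ Suc (card {i\<in>I. x i \<notin> H})) p = 0"
        using p by blast
      moreover obtain c where "\<zeta> = c *\<^sub>R \<eta> H"
        using normal_proportional normal [OF H] unfolding H_def by blast
      ultimately have "(dderiv \<zeta> ^^ Suc (card {i\<in>I. x i \<notin> H})) p = 0"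
        by (simp only: funpow_dderiv_scaleR cpoly.scale_zero_right)
      then show ?thesis by (simp add: H_def)
    qed
    then show "p \<in> facet_kernel I x"
      unfolding facet_kernel_def by blast
  qed
  then show "ideal_kernel (I_plus I x \<eta>) \<subseteq> P_plus I x"
    using facet_kernel_subset_P_plus [OF fin] by blast
qed

subsection \<open>Evaluation of polynomials\<close>

interpretation eval: coeff_hom "\<lambda>c. c"
  by unfold_locales simp_all

lemma cpoly_eval_eq_insertion: "cpoly_eval p t = eval.insertion (\<lambda>k. complex_of_real (t $ k)) p"
  by (simp add: cpoly_eval_def eval.insertion_def)

lemma cpoly_eval_linear_form: "cpoly_eval (linear_form y) t = complex_of_real (y \<bullet> t)"
  unfolding cpoly_eval_eq_insertion linear_form_eq
  by (simp only: eval.insertion_sum eval.insertion_scale eval.insertion_var) (simp add: inner_vec_def)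

lemma has_vector_derivative_cpoly_eval:
  "((\<lambda>s. cpoly_eval p (t + s *\<^sub>R axis k 1)) has_vector_derivative cpoly_eval (partial k p) t) (at 0)"
proof (induction p rule: cpoly_induct)
  case (const c)
  show ?case by (simp add: cpoly_eval_eq_insertion eval.insertion_const partial_single)
next
  case (add p q)
  from has_vector_derivative_add [OF this] show ?case
    by (simp add: cpoly_eval_eq_insertion eval.insertion_add partial_add)
next
  case (var p j)
  have "((\<lambda>s. complex_of_real (t $ j + s * axis k 1 $ j)) has_vector_derivative
      complex_of_real (axis k 1 $ j)) (at 0)"
    by (rule has_vector_derivative_of_real) (auto intro!: derivative_eq_intros)
  from has_vector_derivative_mult [OF var this]
  have "((\<lambda>s. cpoly_eval (p * cpoly_var j) (t + s *\<^sub>R axis k 1)) has_vector_derivative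
      cpoly_eval p t * complex_of_real (axis k 1 $ j) +
      cpoly_eval (partial k p) t * complex_of_real (t $ j)) (at 0)"
    unfolding cpoly_eval_eq_insertion eval.insertion_mult eval.insertion_var by simp
  moreover have "cpoly_eval (partial k (cpoly_var j)) t = complex_of_real (axis k 1 $ j)"
    by (auto simp: partial_single lookup_single axis_def cpoly_eval_eq_insertion)
  ultimately show ?case
    unfolding partial_mult cpoly_eval_eq_insertion eval.insertion_add eval.insertion_mult
      eval.insertion_var by (simp add: add.commute)
qed

lemma cpoly_eval_0: "cpoly_eval p 0 = Poly_Mapping.lookup p 0"
proof -
  have *: "(\<Prod>k\<in>UNIV. (0::complex) ^ Poly_Mapping.lookup m k) = 0"
    if m: "m \<noteq> 0" for m :: "'a \<Rightarrow>\<^sub>0 nat"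
  proof -
    obtain k where "Poly_Mapping.lookup m k \<noteq> 0"
      using m by (metis poly_mapping_eqI lookup_zero)
    then show ?thesis
      by (auto simp: zero_power intro!: prod_zero)
  qed
  have "cpoly_eval p 0 = (\<Sum>m\<in>Poly_Mapping.keys p. if m = 0 then Poly_Mapping.lookup p m else 0)"
    unfolding cpoly_eval_def by (intro sum.cong) (auto simp: *)
  then show ?thesis
    by (auto simp: in_keys_iff)
qed

text \<open>Partial derivatives of a function that vanishes everywhere vanish too, and the
  coefficients are read off from them at the origin.\<close>

lemma cpoly_eq_0_if_eval_0:
  assumes "\<And>t. cpoly_eval p t = 0"
  shows "p = 0"
proof (rule poly_mapping_eqI)
  fix m
  have "Poly_Mapping.lookup p m = 0"
    using assms
  proof (induction m arbitrary: p rule: exponent_induct)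
    case zero
    then show ?case using cpoly_eval_0 by metis
  next
    case (Suc m k)
    have "cpoly_eval (partial k p) t = 0" for t
      using has_vector_derivative_cpoly_eval [of p t k] unfolding Suc.prems
      by (rule vector_derivative_unique_at) simp
    then have "Poly_Mapping.lookup (partial k p) m = 0"
      by (rule Suc.IH)
    then show ?case
      unfolding lookup_partial by (simp del: of_nat_add of_nat_Suc)
  qed
  then show "Poly_Mapping.lookup p m = Poly_Mapping.lookup 0 m"
    by simp
qed

section \<open>Homogeneous polynomials\<close>

lemma cpoly_eval_scaleR_homogeneous:
  assumes "homogeneous d p"
  shows "cpoly_eval p (s *\<^sub>R t) = complex_of_real s ^ d * cpoly_eval p t"
proof -
  have "(\<Prod>k\<in>UNIV. complex_of_real ((s *\<^sub>R t) $ k) ^ Poly_Mapping.lookup m k) =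
      complex_of_real s ^ d * (\<Prod>k\<in>UNIV. complex_of_real (t $ k) ^ Poly_Mapping.lookup m k)"
    if "m \<in> Poly_Mapping.keys p" for m
    using assms that unfolding homogeneous_def
    by (auto simp: power_mult_distrib prod.distrib power_sum)
  then show ?thesis
    unfolding cpoly_eval_def by (simp add: sum_distrib_left mult_ac)
qed

lemma homogeneous_mult:
  assumes "homogeneous d p" "homogeneous e q"
  shows "homogeneous (d + e) (p * q)"
  using assms keys_mult [of p q] unfolding homogeneous_def
  by (fastforce simp: lookup_add sum.distrib)

lemma homogeneous_sum: "(\<And>a. a \<in> A \<Longrightarrow> homogeneous d (f a)) \<Longrightarrow> homogeneous d (\<Sum>a\<in>A. f a)"
  using keys_sum [of f A] unfolding homogeneous_def by blast

lemma homogeneous_single: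
  "(\<Sum>k\<in>UNIV. Poly_Mapping.lookup m k) = d \<Longrightarrow> homogeneous d (Poly_Mapping.single m c)"
  by (simp add: homogeneous_def)

lemma homogeneous_scale: "homogeneous d p \<Longrightarrow> homogeneous d (cpoly_scale c p)"
  using homogeneous_mult [OF homogeneous_single [of 0 0 c]] by (simp add: cpoly_scale_def)

lemma homogeneous_linear_form_power: "homogeneous d (linear_form y ^ d)"
proof (induction d)
  case 0
  show ?case by (simp add: homogeneous_def)
next
  case (Suc d)
  have "(\<Sum>j\<in>UNIV. Poly_Mapping.lookup (Poly_Mapping.single k (1::nat)) j) = 1" for k :: 'a
  proof -
    have "(\<Sum>j\<in>UNIV. Poly_Mapping.lookup (Poly_Mapping.single k (1::nat)) j) =
        (\<Sum>j\<in>UNIV. if j = k then 1 else 0)"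
      by (rule sum.cong) (auto simp: lookup_single)
    then show ?thesis by simp
  qed
  then have "homogeneous 1 (linear_form y)"
    unfolding linear_form_def by (intro homogeneous_sum homogeneous_single)
  from homogeneous_mult [OF this Suc] show ?case by simp
qed

subsection \<open>Power series expansions of exponential sums\<close>

text \<open>Once the lower coefficients vanish, dividing by \<open>s ^ j\<close> leaves a series
  whose limit at 0 is \<open>b j\<close>.\<close>

lemma real_powser_eq_0:
  fixes b :: "nat \<Rightarrow> real"
  assumes "\<And>s. (\<lambda>j. b j * s ^ j) sums 0"
  shows "b j = 0"
proof (induction j rule: less_induct)
  case (less j)
  have "(\<lambda>n. b (n + j) * s ^ n) sums 0" if "s \<noteq> 0" for s
  proof -
    have "(\<lambda>n. b (n + j) * s ^ (n + j)) sums 0"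
      using sums_split_initial_segment [OF assms [of s], of j] less by simp
    from sums_divide [OF this, of "s ^ j"] show ?thesis
      using that by (simp add: power_add)
  qed
  from powser_limit_0_strong [where s = 1 and f = "\<lambda>_. 0", OF _ this]
  have "((\<lambda>_::real. 0) \<longlongrightarrow> b (0 + j)) (at 0)"
    by simp
  then show ?case
    by (simp add: tendsto_const_iff)
qed

text \<open>Along each line through the origin the expansion is a power series in one real variable.
  Uniqueness makes the arbitrary expansions in \<open>least_space\<close> computable as
  \<open>exp_component\<close>.\<close>

lemma homogeneous_expansion_unique:
  assumes F: "homogeneous_expansion f F" and G: "homogeneous_expansion f G"
  shows "F = G"
proof
  fix j
  have "cpoly_eval (F j - G j) t = 0" for t
  proof -
    define a where "a j = cpoly_eval (F j) t - cpoly_eval (G j) t" for j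
    have s: "(\<lambda>j. a j * complex_of_real (s ^ j)) sums 0" for s
    proof -
      have "(\<lambda>j. cpoly_eval (F j) (s *\<^sub>R t) - cpoly_eval (G j) (s *\<^sub>R t)) sums (f (s *\<^sub>R t) - f (s *\<^sub>R t))"
        using F G unfolding homogeneous_expansion_def by (intro sums_diff) auto
      moreover have "cpoly_eval (F j) (s *\<^sub>R t) - cpoly_eval (G j) (s *\<^sub>R t) =
          a j * complex_of_real (s ^ j)" for j
      proof -
        have "homogeneous j (F j)" "homogeneous j (G j)"
          using F G by (simp_all add: homogeneous_expansion_def)
        then show ?thesis
          by (simp add: a_def cpoly_eval_scaleR_homogeneous algebra_simps)
      qed
      ultimately show ?thesis by simp
    qed
    have re: "(\<lambda>j. Re (a j) * s ^ j) sums 0" and im: "(\<lambda>j. Im (a j) * s ^ j) sums 0" for s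
      using sums_Re [OF s [of s]] sums_Im [OF s [of s]] by (simp_all del: of_real_power)
    have "a j = 0"
      using real_powser_eq_0 [OF re] real_powser_eq_0 [OF im] by (simp add: complex_eq_iff)
    then show ?thesis
      by (simp add: a_def cpoly_eval_eq_insertion eval.insertion_diff)
  qed
  then have "F j - G j = 0"
    by (rule cpoly_eq_0_if_eval_0)
  then show "F j = G j" by simp
qed

text \<open>The degree \<open>j\<close> part of
  \<open>\<Sum>a\<in>S. c a * exp (\<alpha> a \<bullet> t)\<close>. Indices are kept apart from
  frequencies because distinct subsets may have equal sums.\<close>

definition exp_component :: "'a set \<Rightarrow> ('a \<Rightarrow> real ^ 'n::finite) \<Rightarrow> ('a \<Rightarrow> complex) \<Rightarrow> nat \<Rightarrow> 'n cpoly" where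
  "exp_component S \<alpha> c j = (\<Sum>a\<in>S. cpoly_scale (c a / fact j) (linear_form (\<alpha> a) ^ j))"

lemma homogeneous_expansion_exp_component:
  "homogeneous_expansion (\<lambda>t. \<Sum>a\<in>S. c a * complex_of_real (exp (\<alpha> a \<bullet> t))) (exp_component S \<alpha> c)"
  unfolding homogeneous_expansion_def
proof (intro conjI allI)
  fix j
  show "homogeneous j (exp_component S \<alpha> c j)"
    unfolding exp_component_def
    by (intro homogeneous_sum homogeneous_scale homogeneous_linear_form_power)
next
  fix t
  have "(\<lambda>j. c a * (complex_of_real (\<alpha> a \<bullet> t) ^ j /\<^sub>R fact j)) sums
      (c a * complex_of_real (exp (\<alpha> a \<bullet> t)))" for a
    using sums_mult [OF exp_converges [of "complex_of_real (\<alpha> a \<bullet> t)"]] by (simp add: exp_of_real)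
  then have "(\<lambda>j. \<Sum>a\<in>S. c a * (complex_of_real (\<alpha> a \<bullet> t) ^ j /\<^sub>R fact j)) sums
      (\<Sum>a\<in>S. c a * complex_of_real (exp (\<alpha> a \<bullet> t)))"
    by (rule sums_sum)
  moreover have "cpoly_eval (exp_component S \<alpha> c j) t =
      (\<Sum>a\<in>S. c a * (complex_of_real (\<alpha> a \<bullet> t) ^ j /\<^sub>R fact j))" for j
  proof -
    have "cpoly_eval (exp_component S \<alpha> c j) t =
        (\<Sum>a\<in>S. c a / fact j * cpoly_eval (linear_form (\<alpha> a)) t ^ j)"
      unfolding exp_component_def cpoly_eval_eq_insertion
      by (simp only: eval.insertion_sum eval.insertion_scale eval.insertion_power)
    then show ?thesis
      by (simp add: cpoly_eval_linear_form scaleR_conv_of_real field_simps)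
  qed
  ultimately show "(\<lambda>j. cpoly_eval (exp_component S \<alpha> c j) t) sums
      (\<Sum>a\<in>S. c a * complex_of_real (exp (\<alpha> a \<bullet> t)))"
    by simp
qed

lemma least_part_eq:
  assumes "F d \<noteq> 0" "\<And>j. j < d \<Longrightarrow> F j = 0"
  shows "least_part F = F d"
proof -
  have "(LEAST j. F j \<noteq> 0) = d"
    using assms by (intro Least_equality) (auto simp: not_less [symmetric])
  with assms(1) show ?thesis
    by (auto simp: least_part_def)
qed

lemma least_part_cases:
  obtains "least_part F = 0"
  | d where "least_part F = F d" "\<And>j. j < d \<Longrightarrow> F j = 0"
proof (cases "\<forall>j. F j = 0")
  case True
  then show ?thesis using that(1) by (simp add: least_part_def)
next
  case False
  show ?thesis
  proof (rule that(2))
    show "least_part F = F (LEAST j. F j \<noteq> 0)"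
      unfolding least_part_def by (simp only: False if_False)
    show "F j = 0" if "j < (LEAST j. F j \<noteq> 0)" for j
      using not_less_Least [OF that] by simp
  qed
qed

subsection \<open>Products of linear forms are least parts\<close>

text \<open>Up to sign the family below is that of the homogeneous components of
  \<open>\<Prod>i\<in>Y. (exp (x i \<bullet> t) - 1)\<close>.\<close>

lemma exp_component_subset_sums:
  assumes "finite Y"
  shows "j < card Y \<Longrightarrow> exp_component (Pow Y) (sum x) (\<lambda>A. (-1) ^ card A) j = 0"
    and "exp_component (Pow Y) (sum x) (\<lambda>A. (-1) ^ card A) (card Y) =
      cpoly_scale ((-1) ^ card Y) (\<Prod>i\<in>Y. linear_form (x i))"
proof -
  let ?T = "\<lambda>Y. exp_component (Pow Y) (sum x) (\<lambda>A. (-1) ^ card A)"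
  have "(\<forall>j<card Y. ?T Y j = 0) \<and>
      ?T Y (card Y) = cpoly_scale ((-1) ^ card Y) (\<Prod>i\<in>Y. linear_form (x i))"
    using assms
  proof (induction Y rule: finite_induct)
    case empty
    show ?case by (simp add: exp_component_def)
  next
    case (insert y Y)
    let ?l = "linear_form (x y)"
    \<comment> \<open>Subsets are separated by whether they contain \<open>y\<close>; those that do
      carry the opposite sign.\<close>
    have split: "?T (insert y Y) j = ?T Y j +
        (\<Sum>A\<in>Pow Y. cpoly_scale (- ((-1) ^ card A) / fact j) ((linear_form (sum x A) + ?l) ^ j))" for j
    proof -
      have inj: "inj_on (insert y) (Pow Y)"
        by (rule inj_onI) (metis PowD insert.hyps(2) insert_ident subsetD)
      have "?T (insert y Y) j = ?T Y j + exp_component (insert y ` Pow Y) (sum x) (\<lambda>A. (-1) ^ card A) j"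
        unfolding exp_component_def Pow_insert using insert.hyps
        by (intro sum.union_disjoint) auto
      also have "exp_component (insert y ` Pow Y) (sum x) (\<lambda>A. (-1) ^ card A) j =
          (\<Sum>A\<in>Pow Y. cpoly_scale ((-1) ^ card (insert y A) / fact j) (linear_form (sum x (insert y A)) ^ j))"
        unfolding exp_component_def by (simp only: sum.reindex [OF inj] o_def)
      also have "\<dots> =
          (\<Sum>A\<in>Pow Y. cpoly_scale (- ((-1) ^ card A) / fact j) ((linear_form (sum x A) + ?l) ^ j))"
      proof (rule sum.cong [OF refl])
        fix A assume "A \<in> Pow Y"
        then have "finite A" "y \<notin> A"
          using insert.hyps finite_subset by auto
        then show "cpoly_scale ((-1) ^ card (insert y A) / fact j) (linear_form (sum x (insert y A)) ^ j) =
            cpoly_scale (- ((-1) ^ card A) / fact j) ((linear_form (sum x A) + ?l) ^ j)"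
          by (simp add: linear_form_add add.commute)
      qed
      finally show ?thesis .
    qed
    have binom: "cpoly_scale (c / fact j) ((p + q) ^ j) =
        (\<Sum>i\<le>j. cpoly_scale (c / fact i) (p ^ i) * cpoly_scale (1 / fact (j - i)) (q ^ (j - i)))"
      for c j and p q :: "'b cpoly"
    proof -
      have of_nat: "of_nat n * r = cpoly_scale (of_nat n) r" for n and r :: "'b cpoly"
        by (induction n) (simp_all add: cpoly.scale_left_distrib distrib_right)
      have "cpoly_scale (c / fact j) ((p + q) ^ j) =
          (\<Sum>i\<le>j. cpoly_scale (c / fact j * of_nat (j choose i)) (p ^ i * q ^ (j - i)))"
        unfolding binomial_ring by (simp add: cpoly.scale_sum_right of_nat cpoly_scale_mult_left)
      also have "\<dots> = (\<Sum>i\<le>j. cpoly_scale (c / fact i) (p ^ i) * cpoly_scale (1 / fact (j - i)) (q ^ (j - i)))"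
      proof (rule sum.cong [OF refl])
        fix i assume "i \<in> {..j}"
        then have "c / fact j * of_nat (j choose i) = c / fact i * (1 / fact (j - i))"
          by (simp add: binomial_fact)
        then show "cpoly_scale (c / fact j * of_nat (j choose i)) (p ^ i * q ^ (j - i)) =
            cpoly_scale (c / fact i) (p ^ i) * cpoly_scale (1 / fact (j - i)) (q ^ (j - i))"
          by (simp add: cpoly_scale_mult_left cpoly_scale_mult_right)
      qed
      finally show ?thesis .
    qed
    \<comment> \<open>This is multiplication by \<open>1 - exp (x y \<bullet> t)\<close>. The
      \<open>i = j\<close> term cancels against the subsets avoiding \<open>y\<close>, which pushes
      the lowest degree up.\<close>
    have rec: "?T (insert y Y) j = - (\<Sum>i<j. ?T Y i * cpoly_scale (1 / fact (j - i)) (?l ^ (j - i)))" for j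
    proof -
      have "(\<Sum>A\<in>Pow Y. cpoly_scale (- ((-1) ^ card A) / fact j) ((linear_form (sum x A) + ?l) ^ j)) =
          (\<Sum>i\<le>j. (\<Sum>A\<in>Pow Y. cpoly_scale (- ((-1) ^ card A) / fact i) (linear_form (sum x A) ^ i)) *
            cpoly_scale (1 / fact (j - i)) (?l ^ (j - i)))"
        unfolding binom sum_distrib_right by (rule sum.swap)
      also have "\<dots> = - (\<Sum>i\<le>j. ?T Y i * cpoly_scale (1 / fact (j - i)) (?l ^ (j - i)))"
        by (simp add: exp_component_def sum_negf)
      also have "{..j} = insert j {..<j}"
        by auto
      finally show ?thesis
        unfolding split by simp
    qed
    have low: "?T (insert y Y) j = 0" if "j < Suc (card Y)" for j
      unfolding rec using that insert.IH by simp
    have "(\<Sum>i<Suc (card Y). ?T Y i * cpoly_scale (1 / fact (Suc (card Y) - i)) (?l ^ (Suc (card Y) - i))) =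
        ?T Y (card Y) * ?l"
      using insert.IH by simp
    then have "?T (insert y Y) (Suc (card Y)) = - (?T Y (card Y) * ?l)"
      unfolding rec by simp
    then have "?T (insert y Y) (Suc (card Y)) =
        cpoly_scale ((-1) ^ Suc (card Y)) (\<Prod>i\<in>insert y Y. linear_form (x i))"
      using insert by (simp add: cpoly_scale_mult_right mult.commute)
    with low insert.hyps show ?case by simp
  qed
  then show "j < card Y \<Longrightarrow> ?T Y j = 0"
    and "?T Y (card Y) = cpoly_scale ((-1) ^ card Y) (\<Prod>i\<in>Y. linear_form (x i))"
    by auto
qed

text \<open>Collects the coefficients of equal frequencies, as membership in
  \<open>Exp_space\<close> requires.\<close>

lemma exp_component_regroup:
  assumes "finite S" "finite \<sigma>" "\<alpha> ` S \<subseteq> \<sigma>"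
  shows "exp_component S \<alpha> w = exp_component \<sigma> (\<lambda>a. a) (\<lambda>a. \<Sum>s\<in>{s\<in>S. \<alpha> s = a}. w s)"
proof
  fix j
  have "exp_component S \<alpha> w j =
      (\<Sum>a\<in>\<sigma>. \<Sum>s\<in>{s\<in>S. \<alpha> s = a}. cpoly_scale (w s / fact j) (linear_form (\<alpha> s) ^ j))"
    unfolding exp_component_def by (rule sum.group [OF assms, symmetric])
  also have "\<dots> = (\<Sum>a\<in>\<sigma>. \<Sum>s\<in>{s\<in>S. \<alpha> s = a}. cpoly_scale (w s / fact j) (linear_form a ^ j))"
    by (intro sum.cong refl) auto
  also have "\<dots> = exp_component \<sigma> (\<lambda>a. a) (\<lambda>a. \<Sum>s\<in>{s\<in>S. \<alpha> s = a}. w s) j"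
    by (simp add: exp_component_def sum_divide_distrib cpoly.scale_sum_left)
  finally show "exp_component S \<alpha> w j = exp_component \<sigma> (\<lambda>a. a) (\<lambda>a. \<Sum>s\<in>{s\<in>S. \<alpha> s = a}. w s) j" .
qed

lemma P_plus_subset_least_space:
  assumes "finite I" "finite \<sigma>" and sums: "\<And>Y. Y \<subseteq> I \<Longrightarrow> sum x Y \<in> \<sigma>"
  shows "P_plus I x \<subseteq> least_space \<sigma>"
  unfolding P_plus_def
proof (rule cpoly.span_minimal)
  show "cpoly.subspace (least_space \<sigma>)"
    unfolding least_space_def by (rule cpoly.subspace_span)
  show "{\<Prod>i\<in>Y. linear_form (x i) |Y. Y \<subseteq> I} \<subseteq> least_space \<sigma>"
  proof clarify
    fix Y assume Y: "Y \<subseteq> I"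
    then have fin: "finite Y"
      using assms(1) finite_subset by blast
    let ?p = "\<Prod>i\<in>Y. linear_form (x i)"
    let ?F = "exp_component (Pow Y) (sum x) (\<lambda>A. (-1) ^ card A)"
    define c where "c a = (\<Sum>A\<in>{A\<in>Pow Y. sum x A = a}. (-1 :: complex) ^ card A)" for a
    have F: "?F = exp_component \<sigma> (\<lambda>a. a) c"
      unfolding c_def using fin Y assms by (intro exp_component_regroup) auto
    show "?p \<in> least_space \<sigma>"
    \<comment> \<open>Only a nonzero product certifies that degree \<open>card Y\<close> is the
      lowest one present.\<close>
    proof (cases "?p = 0")
      case True
      then show ?thesis
        unfolding least_space_def by (simp add: cpoly.span_zero)
    next
      case False
      have "least_part ?F = ?F (card Y)"
        using False exp_component_subset_sums [OF fin, where x = x] by (intro least_part_eq) auto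
      moreover have "(\<lambda>t. \<Sum>a\<in>\<sigma>. c a * complex_of_real (exp (a \<bullet> t))) \<in> Exp_space \<sigma>"
        unfolding Exp_space_def by blast
      then have "least_part ?F \<in> least_space \<sigma>"
        unfolding least_space_def F
        using homogeneous_expansion_exp_component [where S = \<sigma> and \<alpha> = "\<lambda>a. a" and c = c]
        by (intro cpoly.span_base) blast
      ultimately have "cpoly_scale ((-1) ^ card Y) (?F (card Y)) \<in> least_space \<sigma>"
        unfolding least_space_def by (simp add: cpoly.span_scale)
      then show ?thesis
        unfolding exp_component_subset_sums(2) [OF fin] by (simp flip: power_mult_distrib)
    qed
  qed
qed

subsection \<open>Differential equations of least parts\<close>

lemma dderiv_linear_form_power:
  "dderiv \<eta> (linear_form a ^ Suc j) =
     cpoly_scale (of_nat (Suc j) * complex_of_real (\<eta> \<bullet> a)) (linear_form a ^ j)"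
proof (induction j)
  case 0
  show ?case by (simp add: dderiv_linear_form cpoly_scale_def)
next
  case (Suc j)
  have "dderiv \<eta> (linear_form a ^ Suc (Suc j)) =
      linear_form a * dderiv \<eta> (linear_form a ^ Suc j) +
      cpoly_scale (complex_of_real (\<eta> \<bullet> a)) (linear_form a ^ Suc j)"
    unfolding power_Suc [of _ "Suc j"] dderiv_mult_linear_form ..
  then show ?case
    unfolding Suc
    by (simp add: cpoly_scale_mult_right cpoly.scale_left_distrib [symmetric] algebra_simps
        del: cpoly.scale_left_distrib)
qed

text \<open>Exponentials are eigenfunctions of the derivative, with eigenvalue
  \<open>\<eta> \<bullet> \<alpha> a\<close>; this is that fact read off degree by degree.\<close>

lemma dderiv_exp_component_Suc:
  "dderiv \<eta> (exp_component S \<alpha> c (Suc j)) =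
     exp_component S \<alpha> (\<lambda>a. complex_of_real (\<eta> \<bullet> \<alpha> a) * c a) j"
proof -
  have "c a / fact (Suc j) * (of_nat (Suc j) * complex_of_real (\<eta> \<bullet> \<alpha> a)) =
      complex_of_real (\<eta> \<bullet> \<alpha> a) * c a / fact j" for a
    by (simp add: fact_Suc field_simps del: of_nat_Suc)
  then show ?thesis
    unfolding exp_component_def diff_op_sum_right diff_op_scale_right dderiv_linear_form_power
      cpoly.scale_scale by simp
qed

lemma funpow_dderiv_exp_component: "(dderiv \<eta> ^^ Suc d) (exp_component S \<alpha> c d) = 0"
proof (induction d arbitrary: c)
  case 0
  show ?case by (simp add: exp_component_def diff_op_sum_right diff_op_scale_right)
next
  case (Suc d)
  then show ?case
    unfolding funpow_Suc_right [of "Suc d"] o_apply dderiv_exp_component_Suc .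
qed

text \<open>Applying \<open>\<Prod>v\<in>V. (dderiv \<eta> - v)\<close> to the exponential sum multiplies its coefficients by
  \<open>\<Prod>v\<in>V. (\<eta> \<bullet> \<alpha> a - v)\<close>, whereas on its least part only the leading term
  \<open>dderiv \<eta> ^^ card V\<close> contributes.\<close>

lemma exp_component_annihilate:
  assumes "finite V" and low: "\<And>j. j < d \<Longrightarrow> exp_component S \<alpha> c j = 0" and "j + card V \<le> d"
  shows "exp_component S \<alpha> (\<lambda>a. (\<Prod>v\<in>V. complex_of_real (\<eta> \<bullet> \<alpha> a - v)) * c a) j =
    (if j + card V = d then (dderiv \<eta> ^^ card V) (exp_component S \<alpha> c d) else 0)"
  using assms(1,3)
proof (induction V arbitrary: j rule: finite_induct)
  case empty
  then show ?case using low by simp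
next
  case (insert v V)
  let ?w = "\<lambda>a. (\<Prod>v\<in>V. complex_of_real (\<eta> \<bullet> \<alpha> a - v)) * c a"
  have "exp_component S \<alpha> (\<lambda>a. (\<Prod>v\<in>insert v V. complex_of_real (\<eta> \<bullet> \<alpha> a - v)) * c a) j =
      exp_component S \<alpha> (\<lambda>a. complex_of_real (\<eta> \<bullet> \<alpha> a) * ?w a) j -
      cpoly_scale (complex_of_real v) (exp_component S \<alpha> ?w j)"
  proof -
    have "(\<Prod>v\<in>insert v V. complex_of_real (\<eta> \<bullet> \<alpha> a - v)) * c a / fact j =
        complex_of_real (\<eta> \<bullet> \<alpha> a) * ?w a / fact j - complex_of_real v * (?w a / fact j)" for a
      using insert.hyps by (simp add: field_simps)
    then show ?thesis
      unfolding exp_component_def cpoly.scale_sum_right sum_subtractf [symmetric] cpoly.scale_scale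
        cpoly.scale_left_diff_distrib [symmetric]
      by (simp only:)
  qed
  also have "\<dots> = dderiv \<eta> (exp_component S \<alpha> ?w (Suc j)) -
      cpoly_scale (complex_of_real v) (exp_component S \<alpha> ?w j)"
    unfolding dderiv_exp_component_Suc ..
  \<comment> \<open>The subtracted term vanishes because \<open>j + card V\<close> is strictly below
    \<open>d\<close>; only the differentiated one can reach degree \<open>d\<close>.\<close>
  also have "\<dots> = (if j + card (insert v V) = d
      then (dderiv \<eta> ^^ card (insert v V)) (exp_component S \<alpha> c d) else 0)"
    using insert.IH [of "Suc j"] insert.IH [of j] insert.prems insert.hyps by simp
  finally show ?case .
qed

text \<open>Every frequency has its value in \<open>V\<close>, so the annihilated sum is zero, in
  particular in degree \<open>d - card V\<close>. If \<open>card V\<close> exceeds \<open>d\<close>,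
  the degree alone suffices.\<close>

lemma funpow_dderiv_least_component:
  assumes V: "finite V" "card V \<le> N" "\<And>a. a \<in> S \<Longrightarrow> \<eta> \<bullet> \<alpha> a \<in> V"
    and low: "\<And>j. j < d \<Longrightarrow> exp_component S \<alpha> c j = 0"
  shows "(dderiv \<eta> ^^ N) (exp_component S \<alpha> c d) = 0"
proof (cases "card V \<le> d")
  case True
  have "(\<Prod>v\<in>V. complex_of_real (\<eta> \<bullet> \<alpha> a - v)) = 0" if "a \<in> S" for a
    using V(1) V(3) [OF that] by (intro prod_zero) auto
  then have "exp_component S \<alpha> (\<lambda>a. (\<Prod>v\<in>V. complex_of_real (\<eta> \<bullet> \<alpha> a - v)) * c a) (d - card V) = 0"
    unfolding exp_component_def by (intro sum.neutral) simp
  with exp_component_annihilate [OF V(1) low, where j = "d - card V" and \<eta> = \<eta>] True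
  have "(dderiv \<eta> ^^ card V) (exp_component S \<alpha> c d) = 0"
    by simp
  then show ?thesis
    using V(2) by (rule funpow_dderiv_mono)
next
  case False
  with V(2) have "Suc d \<le> N" by simp
  then show ?thesis
    using funpow_dderiv_mono [OF funpow_dderiv_exp_component] by blast
qed

lemma least_space_subset_funpow_dderiv_kernel:
  assumes "finite V" "card V \<le> N" "\<And>a. a \<in> \<sigma> \<Longrightarrow> \<eta> \<bullet> a \<in> V"
  shows "least_space \<sigma> \<subseteq> {p. (dderiv \<eta> ^^ N) p = 0}"
  unfolding least_space_def
proof (intro cpoly.span_minimal subspace_funpow_dderiv_kernel, clarify)
  fix f F assume f: "f \<in> Exp_space \<sigma>" and F: "homogeneous_expansion f F"
  from f obtain c where f_eq: "f = (\<lambda>t. \<Sum>a\<in>\<sigma>. c a * complex_of_real (exp (a \<bullet> t)))"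
    unfolding Exp_space_def by blast
  have "homogeneous_expansion f (exp_component \<sigma> (\<lambda>a. a) c)"
    unfolding f_eq by (rule homogeneous_expansion_exp_component)
  with F have F_eq: "F = exp_component \<sigma> (\<lambda>a. a) c"
    by (rule homogeneous_expansion_unique)
  show "(dderiv \<eta> ^^ N) (least_part F) = 0"
  proof (cases F rule: least_part_cases)
    case 1
    then show ?thesis by simp
  next
    case (2 d)
    have "(dderiv \<eta> ^^ N) (F d) = 0"
      using assms 2(2) unfolding F_eq by (rule funpow_dderiv_least_component)
    with 2(1) show ?thesis
      by simp
  qed
qed

subsection \<open>Integer points of unimodular zonotopes\<close>

lemma finite_bounded_integer_points:
  fixes S :: "(real ^ 'n::finite) set"
  assumes "bounded S"
  shows "finite (S \<inter> integer_points)"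
proof -
  obtain B where B: "\<And>z. z \<in> S \<Longrightarrow> norm z \<le> B"
    using assms by (auto simp: bounded_iff)
  let ?A = "PiE (UNIV :: 'n set) (\<lambda>_. {-\<lceil>B\<rceil>..\<lceil>B\<rceil>})"
  have "S \<inter> integer_points \<subseteq> (\<lambda>f. \<chi> k. real_of_int (f k)) ` ?A"
  proof
    fix z assume z: "z \<in> S \<inter> integer_points"
    have "\<bar>z $ k\<bar> \<le> B" for k
      using B [of z] z component_le_norm_cart [of z k] by auto
    then have "\<lfloor>z $ k\<rfloor> \<in> {-\<lceil>B\<rceil>..\<lceil>B\<rceil>}" for k
      by (auto simp: abs_le_iff le_floor_iff)
        (smt (verit) ceiling_correct floor_correct le_of_int_ceiling of_int_le_iff of_int_minus)+
    moreover have "z = (\<chi> k. real_of_int \<lfloor>z $ k\<rfloor>)"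
      using z by (auto simp: vec_eq_iff integer_points_def elim: Ints_cases)
    ultimately show "z \<in> (\<lambda>f. \<chi> k. real_of_int (f k)) ` ?A"
      by (intro image_eqI [where x = "\<lambda>k. \<lfloor>z $ k\<rfloor>"]) auto
  qed
  moreover have "finite ?A"
    by (intro finite_PiE) auto
  ultimately show ?thesis
    by (meson finite_imageI finite_subset)
qed

lemma bounded_zonotope: "bounded (zonotope I x)"
proof -
  have "norm z \<le> (\<Sum>i\<in>I. norm (x i))" if mem: "z \<in> zonotope I x" for z
  proof -
    obtain s where s: "\<forall>i\<in>I. s i \<in> {0..1}" and z: "z = (\<Sum>i\<in>I. s i *\<^sub>R x i)"
      using mem unfolding zonotope_def by blast
    have "norm (s i *\<^sub>R x i) \<le> norm (x i)" if "i \<in> I" for i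
      using s that by (auto simp: mult_left_le_one_le)
    then show ?thesis
      unfolding z by (intro sum_norm_le)
  qed
  then show ?thesis
    by (auto simp: bounded_iff)
qed

lemma subset_sum_in_zonotope:
  assumes "finite I" "x ` I \<subseteq> integer_points" "Y \<subseteq> I"
  shows "sum x Y \<in> zonotope I x \<inter> integer_points"
proof
  have "(\<Sum>i\<in>I. of_bool (i \<in> Y) *\<^sub>R x i) = (\<Sum>i\<in>I. if i \<in> Y then x i else 0)"
    by (rule sum.cong) auto
  also have "\<dots> = sum x Y"
    using assms by (simp add: sum.inter_restrict [symmetric] Int_absorb1)
  finally show "sum x Y \<in> zonotope I x"
    unfolding zonotope_def by (intro CollectI exI [of _ "\<lambda>i. of_bool (i \<in> Y)"]) auto
  show "sum x Y \<in> integer_points"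
    using assms unfolding integer_points_def by (auto intro!: Ints_sum)
qed

section \<open>Integral linear forms vanishing on a facet hyperplane\<close>

lemma det_in_Ints:
  fixes A :: "real ^ 'n ^ 'n"
  assumes "\<And>i j. A $ i $ j \<in> \<int>"
  shows "det A \<in> \<int>"
  unfolding det_def using assms by (intro Ints_sum Ints_mult Ints_prod Ints_of_int)

text \<open>The form \<open>\<phi>\<close> is the determinant with one column left free, the other columns being a
  basis of the facet chosen from the family.\<close>

lemma unimodular_facet_form:
  fixes x :: "'i \<Rightarrow> real ^ 'n::finite"
  assumes fin: "finite I" and sp: "span (x ` I) = UNIV" and um: "unimodular I x"
    and H: "H \<in> facet_hyperplanes I x" and y: "is_normal H y"
  obtains \<phi> :: "real ^ 'n \<Rightarrow> real" and u :: real
  where "linear \<phi>" "\<And>z. y \<bullet> z = u * \<phi> z" "\<And>z. z \<in> integer_points \<Longrightarrow> \<phi> z \<in> \<int>"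
    "\<And>i. i \<in> I \<Longrightarrow> x i \<in> H \<Longrightarrow> \<phi> (x i) = 0"
    "\<And>i. i \<in> I \<Longrightarrow> x i \<notin> H \<Longrightarrow> \<phi> (x i) \<in> {1, -1}"
proof -
  have sH: "subspace H" and dH: "dim H = CARD('n) - 1"
    and spH: "span (x ` {i\<in>I. x i \<in> H}) = H"
    using H by (auto simp: facet_hyperplanes_def)
  obtain C where C: "C \<subseteq> x ` {i\<in>I. x i \<in> H}" "independent C"
    "x ` {i\<in>I. x i \<in> H} \<subseteq> span C" "card C = dim (x ` {i\<in>I. x i \<in> H})"
    using basis_exists by blast
  have "span C = H"
    using C(1,3) spH by (metis span_mono span_minimal subspace_span subset_antisym)
  \<comment> \<open>Unimodularity quantifies over index sets, so one index is chosen for each basis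
    vector of the facet.\<close>
  obtain J where J: "J \<subseteq> {i\<in>I. x i \<in> H}" "inj_on x J" "C = x ` J"
    using C(1) unfolding subset_image_inj by blast
  have finJ: "finite J"
    using J(1) fin by (auto intro: finite_subset)
  have cardC: "card C = CARD('n) - 1"
    using C(4) dH spH by (metis dim_span)
  then have cardJ: "card J = CARD('n) - 1"
    using J card_image by metis
  have full: "dim (insert z C) = CARD('n)" "independent (insert z C)" "span (insert z C) = UNIV"
    if "z \<notin> H" for z
  proof -
    have "z \<notin> span C"
      using that \<open>span C = H\<close> by simp
    then show d: "dim (insert z C) = CARD('n)"
      using dim_eq_card_independent [OF C(2)] cardC by (simp add: dim_insert)
    show "independent (insert z C)"
      using \<open>z \<notin> span C\<close> C(2) by (simp add: independent_insertI)
    show "span (insert z C) = UNIV"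
      using d dim_eq_full [of "insert z C"] by simp
  qed
  \<comment> \<open>\<open>CARD('n)\<close> is positive, so the truncated difference is a genuine
    drop in dimension.\<close>
  have "H \<noteq> UNIV"
    using dH zero_less_card_finite [where 'a = 'n] by (auto simp del: zero_less_card_finite)
  then obtain i0 where i0: "i0 \<in> I" "x i0 \<notin> H"
    using sp sH span_minimal [of "x ` I" H] by blast
  fix k0 :: 'n
  have "card (UNIV - {k0}) = card J"
    by (simp add: cardJ card_Diff_singleton)
  then obtain e where e: "bij_betw e (UNIV - {k0}) J"
    using finite_same_card_bij finJ by (metis finite)
  \<comment> \<open>The vectors enter as rows, where the linearity of the determinant is used; a
    transpose later matches the columns in \<open>unimodular\<close>.\<close>
  define \<phi> where "\<phi> z = det (\<chi> c. if c = k0 then z else x (e c))" for z :: "real ^ 'n"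
  have lin: "linear \<phi>"
  proof (rule linearI)
    show "\<phi> (a + b) = \<phi> a + \<phi> b" for a b
      unfolding \<phi>_def by (rule det_row_add)
    show "\<phi> (c *\<^sub>R a) = c *\<^sub>R \<phi> a" for c a
      unfolding \<phi>_def
      using det_row_mul [of k0 c "\<lambda>_. a" "\<lambda>c. x (e c)", unfolded scalar_mult_eq_scaleR] by simp
  qed
  have \<phi>H: "\<phi> z = 0" if "z \<in> H" for z
  proof (rule linear_eq_0_on_span [OF lin])
    show "z \<in> span C"
      using that \<open>span C = H\<close> by simp
    fix w assume "w \<in> C"
    then obtain k where k: "k \<noteq> k0" "w = x (e k)"
      using e J(3) by (auto simp: bij_betw_def)
    show "\<phi> w = 0"
      unfolding \<phi>_def by (rule det_identical_rows [OF k(1)]) (auto simp: row_def k vec_eq_iff)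
  qed
  have \<phi>1: "\<phi> (x i) \<in> {1, -1}" if i: "i \<in> I" "x i \<notin> H" for i
  proof -
    have "i \<notin> J" "x i \<notin> x ` J"
      using i J by auto
    have "bij_betw (e(k0 := i)) UNIV (insert i J)"
    proof -
      have "bij_betw (e(k0 := i)) (UNIV - {k0}) J"
        using e by (rule bij_betw_cong [THEN iffD1, rotated]) auto
      from notIn_Un_bij_betw [of k0 "UNIV - {k0}" "e(k0 := i)" J] this \<open>i \<notin> J\<close>
      show ?thesis by (simp add: insert_UNIV Un_commute)
    qed
    moreover have "is_basis_family (insert i J) x"
      using full [OF i(2)] J \<open>x i \<notin> x ` J\<close> unfolding is_basis_family_def by (auto simp: inj_on_insert)
    moreover have "insert i J \<subseteq> I"
      using i J by auto
    ultimately have "det (\<chi> r c. x ((e(k0 := i)) c) $ r) \<in> {1, -1}"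
      using um unfolding unimodular_def by blast
    moreover have "(\<chi> r c. x ((e(k0 := i)) c) $ r) = transpose (\<chi> c. if c = k0 then x i else x (e c))"
      by (simp add: transpose_def vec_eq_iff)
    ultimately show ?thesis
      by (simp add: \<phi>_def)
  qed
  \<comment> \<open>Both forms vanish on \<open>H\<close> and \<open>x i0\<close> spans a
    complement, so they differ by the ratio of their values there.\<close>
  have "y \<bullet> z = ((y \<bullet> x i0) / \<phi> (x i0)) * \<phi> z" for z
  proof -
    have "z \<in> span (insert (x i0) C)"
      using full [OF i0(2)] by simp
    then obtain c where "z - c *\<^sub>R x i0 \<in> H"
      unfolding span_breakdown_eq \<open>span C = H\<close> by blast
    then have "y \<bullet> (z - c *\<^sub>R x i0) = 0" "\<phi> (z - c *\<^sub>R x i0) = 0"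
      using y \<phi>H by (auto simp: is_normal_def)
    then have "y \<bullet> z = c * (y \<bullet> x i0)" "\<phi> z = c * \<phi> (x i0)"
      using lin by (simp_all add: inner_diff_right linear_diff linear_cmul)
    moreover have "\<phi> (x i0) \<noteq> 0"
      using \<phi>1 [OF i0] by auto
    ultimately show ?thesis by simp
  qed
  moreover have "\<phi> z \<in> \<int>" if z: "z \<in> integer_points" for z
    unfolding \<phi>_def
  proof (rule det_in_Ints)
    fix c r
    show "(\<chi> c. if c = k0 then z else x (e c)) $ c $ r \<in> \<int>"
    proof (cases "c = k0")
      case False
      then have "e c \<in> I"
        using e J(1) by (auto simp: bij_betw_def)
      then show ?thesis
        using um False by (auto simp: unimodular_def integer_points_def)
    qed (use z in \<open>simp add: integer_points_def\<close>)
  qed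
  ultimately show thesis
    using that [of \<phi>] lin \<phi>H \<phi>1 by blast
qed

text \<open>The form \<open>\<phi>\<close> is integral on these points and lies between minus the
  number of vectors with value -1 and the number with value 1.\<close>

lemma unimodular_facet_values:
  fixes x :: "'i \<Rightarrow> real ^ 'n::finite"
  assumes fin: "finite I" and sp: "span (x ` I) = UNIV" and um: "unimodular I x"
    and H: "H \<in> facet_hyperplanes I x" and y: "is_normal H y"
  obtains V where "finite V" "card V \<le> Suc (card {i\<in>I. x i \<notin> H})"
    "\<And>z. z \<in> zonotope I x \<inter> integer_points \<Longrightarrow> y \<bullet> z \<in> V"
proof -
  obtain \<phi> u where \<phi>: "linear \<phi>" "\<And>z. y \<bullet> z = u * \<phi> z" "\<And>z. z \<in> integer_points \<Longrightarrow> \<phi> z \<in> \<int>"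
    "\<And>i. i \<in> I \<Longrightarrow> x i \<in> H \<Longrightarrow> \<phi> (x i) = 0"
    "\<And>i. i \<in> I \<Longrightarrow> x i \<notin> H \<Longrightarrow> \<phi> (x i) \<in> {1, -1}"
    using unimodular_facet_form [OF assms] by metis
  define P where "P = {i\<in>I. \<phi> (x i) = 1}"
  define N where "N = {i\<in>I. \<phi> (x i) = -1}"
  \<comment> \<open>The factor \<open>u\<close> undoes the rescaling from \<open>y\<close> to
    \<open>\<phi>\<close>. The closed interval includes 0, which accounts for the additional
    \<open>Suc\<close> in the bound.\<close>
  define V where "V = (\<lambda>k. u * real_of_int k) ` {- int (card N)..int (card P)}"
  have PN: "finite P" "finite N" "P \<inter> N = {}" "P \<union> N = {i\<in>I. x i \<notin> H}"
    using fin \<phi>(4,5) by (auto simp: P_def N_def)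
  show thesis
  proof
    show "finite V"
      by (simp add: V_def)
    have "card V \<le> card {- int (card N)..int (card P)}"
      unfolding V_def by (rule card_image_le) simp
    also have "\<dots> = Suc (card P + card N)"
      by simp
    also have "card P + card N = card {i\<in>I. x i \<notin> H}"
      using PN card_Un_disjoint by metis
    finally show "card V \<le> Suc (card {i\<in>I. x i \<notin> H})" .
    fix z assume z: "z \<in> zonotope I x \<inter> integer_points"
    then obtain s where s: "\<forall>i\<in>I. s i \<in> {0..1}" and z_eq: "z = (\<Sum>i\<in>I. s i *\<^sub>R x i)"
      unfolding zonotope_def by blast
    have \<phi>z: "\<phi> z = (\<Sum>i\<in>I. s i * \<phi> (x i))"
      unfolding z_eq using \<phi>(1) by (simp add: linear_sum linear_cmul)
    \<comment> \<open>A coefficient in the unit interval contributes at most 1 where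
      \<open>\<phi>\<close> is 1 on the vector and at most 0 elsewhere.\<close>
    have "\<phi> z \<le> (\<Sum>i\<in>I. if i \<in> P then 1 else 0)"
      unfolding \<phi>z using s \<phi>(4,5) by (intro sum_mono) (fastforce simp: P_def)
    moreover have "(\<Sum>i\<in>I. if i \<in> N then -1 else 0) \<le> \<phi> z"
      unfolding \<phi>z using s \<phi>(4,5) by (intro sum_mono) (fastforce simp: N_def)
    moreover have "P \<subseteq> I" "N \<subseteq> I"
      by (auto simp: P_def N_def)
    ultimately have "- real (card N) \<le> \<phi> z" "\<phi> z \<le> real (card P)"
      using fin by (simp_all add: sum.inter_restrict [symmetric] Int_absorb1)
    moreover obtain k where "\<phi> z = real_of_int k"
      using \<phi>(3) [of z] z by (auto elim: Ints_cases)
    ultimately show "y \<bullet> z \<in> V"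
      unfolding V_def \<phi>(2) by (auto simp: V_def intro!: image_eqI [where x = k])
  qed
qed

theorem theorem4p11:
  fixes I :: "'i set" and x :: "'i \<Rightarrow> real ^ 'n::finite"
    and \<eta> :: "(real ^ 'n) set \<Rightarrow> real ^ 'n"
  assumes "finite I"
    and "\<And>i. i \<in> I \<Longrightarrow> x i \<noteq> 0"
    and "span (x ` I) = UNIV"
    and "unimodular I x"
    and "\<And>H. H \<in> facet_hyperplanes I x \<Longrightarrow> is_normal H (\<eta> H)"
  shows "least_space (zonotope I x \<inter> integer_points) = P_plus I x \<and>
    P_plus I x = ideal_kernel (I_plus I x \<eta>)"
proof -
  let ?\<sigma> = "zonotope I x \<inter> integer_points"
  have ker: "P_plus I x = ideal_kernel (I_plus I x \<eta>)"
    using assms(1,3,5) by (rule P_plus_eq_ideal_kernel)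
  have "finite ?\<sigma>"
    using bounded_zonotope by (rule finite_bounded_integer_points)
  moreover have "x ` I \<subseteq> integer_points"
    using assms(4) by (simp add: unimodular_def)
  ultimately have "P_plus I x \<subseteq> least_space ?\<sigma>"
    using assms(1) subset_sum_in_zonotope by (intro P_plus_subset_least_space)
  moreover have "least_space ?\<sigma> \<subseteq> ideal_kernel (I_plus I x \<eta>)"
  proof -
    have "least_space ?\<sigma> \<subseteq> {p. (dderiv (\<eta> H) ^^ Suc (card {i\<in>I. x i \<notin> H})) p = 0}"
      if H: "H \<in> facet_hyperplanes I x" for H
    proof -
      obtain V where V: "finite V" "card V \<le> Suc (card {i\<in>I. x i \<notin> H})"
        "\<And>z. z \<in> ?\<sigma> \<Longrightarrow> \<eta> H \<bullet> z \<in> V"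
        using unimodular_facet_values [OF assms(1,3,4) H assms(5) [OF H]] by blast
      then show ?thesis
        by (rule least_space_subset_funpow_dderiv_kernel)
    qed
    then show ?thesis
      unfolding ideal_kernel_I_plus by blast
  qed
  ultimately show ?thesis
    using ker by auto
qed

end
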